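(* Let $\ell\ge 2$ be an integer. The $\ell$-generalized Fibonacci zeta function $\zeta_{F^{(\ell)}}(s)=\sum_{n=1}^{\infty}\left(F_n^{(\ell)}\right)^{-s}$ (defined for $\mathrm{Re}(s)>0$) can be meromorphically continued to the whole complex plane $\mathbb{C}$, with possible simple poles at the points $$s_{k,k_2,\ldots,k_\ell,n}=-k+\frac{2n i\pi+k_2\log\alpha_2+\cdots+k_\ell\log\alpha_\ell}{\log\alpha},\qquad n\in\mathbb{Z},\ k,k_2,\ldots,k_\ell\in\mathbb{N}_0,\ k=k_2+k_3+\cdots+k_\ell$$ (that is, the continuation is holomorphic away from these points, and at each of them it has at most a simple pole). Moreover, the residue of $\zeta_{F^{(\ell)}}(s)$ at $s=s_{k,k_2,\ldots,k_\ell,n}$ is $$\left(\frac{\alpha-1}{2+(\ell+1)(\alpha-2)}\alpha^{-1}\right)^{-s_{k,k_2,\ldots,k_\ell,n}}\binom{-s_{k,k_2,\ldots,k_\ell,n}}{k}\left(\frac{\alpha-1}{2+(\ell+1)(\alpha-2)}\alpha^{-1}\right)^{-k}\frac{k!}{k_2!\cdots k_\ell!}\prod_{i=2}^{\ell}\left(\frac{\alpha_i-1}{2+(\ell+1)(\alpha_i-2)}\alpha_i^{-1}\right)^{k_i}\frac{1}{\log\alpha}.$$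
   Context: For an integer $\ell\ge 2$, the $\ell$-generalized Fibonacci sequence $\left(F_n^{(\ell)}\right)_{n\ge 2-\ell}$ is defined by $F_{-(\ell-2)}^{(\ell)}=F_{-(\ell-3)}^{(\ell)}=\cdots=F_0^{(\ell)}=0$, $F_1^{(\ell)}=1$, and $F_n^{(\ell)}=F_{n-1}^{(\ell)}+F_{n-2}^{(\ell)}+\cdots+F_{n-\ell}^{(\ell)}$ for $n\ge 2$. Its characteristic polynomial is $\phi_\ell(x)=x^\ell-x^{\ell-1}-\cdots-x-1$, which is irreducible over $\mathbb{Q}$ and has exactly one root $\alpha=\alpha_1$ outside the unit circle; this root is real and lies between $2(1-2^{-\ell})$ and $2$. The other roots of $\phi_\ell$ are denoted $\alpha_2,\ldots,\alpha_\ell$. $\mathbb{N}_0$ is the set of non-negative integers, $i$ outside of index position is the imaginary unit, and $\log\alpha_j$ ($j=1,\ldots,\ell$) denotes the principal value of the logarithm, with imaginary part in $(-\pi,\pi]$. For complex $z$ and $k\in\mathbb{N}_0$, $\binom{z}{k}=z(z-1)\cdots(z-k+1)/k!$. The number $\frac{\alpha-1}{2+(\ell+1)(\alpha-2)}\alpha^{-1}$ is a positive real number, and its complex powers are taken with the real logarithm. *)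

theory Defs
  imports "HOL-Complex_Analysis.Complex_Analysis"
begin

(* The sequence is extended by 0 to all indices n <= 0; only the values at n >= 2 - l enter
   the recurrence for n >= 2. *)
function gfib :: "nat \<Rightarrow> int \<Rightarrow> nat" where
  "gfib l n = (if n \<le> 0 then 0 else if n = 1 then 1 else (\<Sum>j\<in>{1..l}. gfib l (n - int j)))"
  by pat_completeness auto
termination
  by (relation "Wellfounded.measure (\<lambda>(l, n). nat n)") auto

declare gfib.simps [simp del]

definition gfib_poly :: "nat \<Rightarrow> complex poly" where
  "gfib_poly l = monom 1 l - (\<Sum>j<l. monom 1 j)"

(* \<alpha> 1, ..., \<alpha> l list the complex roots of gfib_poly l with multiplicity, in any order such
   that \<alpha> 1 is the root outside the unit circle. *)
definition gfib_roots :: "nat \<Rightarrow> (nat \<Rightarrow> complex) \<Rightarrow> bool" where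
  "gfib_roots l \<alpha> \<longleftrightarrow>
     gfib_poly l = (\<Prod>i\<in>{1..l}. [:- \<alpha> i, 1:]) \<and> cmod (\<alpha> 1) > 1"

definition gfib_zeta_term :: "nat \<Rightarrow> complex \<Rightarrow> nat \<Rightarrow> complex" where
  "gfib_zeta_term l s n = of_nat (gfib l (int n)) powr (- s)"

(* The series starts at n = 1, hence the shift of the summation index. *)
definition gfib_zeta :: "nat \<Rightarrow> complex \<Rightarrow> complex" where
  "gfib_zeta l s = (\<Sum>n. gfib_zeta_term l s (Suc n))"

(* Binet formula: gfib l n is the sum of gfib_coeff l x * x ^ n over the roots x of gfib_poly l
   (n >= 1). *)
definition gfib_coeff :: "nat \<Rightarrow> complex \<Rightarrow> complex" where
  "gfib_coeff l x = (x - 1) / (2 + (of_nat l + 1) * (x - 2)) * inverse x"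

(* Only the values \<kappa> 2, ..., \<kappa> l of the exponent vector are used. Ln is the principal branch,
   with imaginary part in (-pi, pi]. *)
definition gfib_pole ::
    "nat \<Rightarrow> (nat \<Rightarrow> complex) \<Rightarrow> nat \<Rightarrow> (nat \<Rightarrow> nat) \<Rightarrow> int \<Rightarrow> complex" where
  "gfib_pole l \<alpha> k \<kappa> n =
     - of_nat k + (2 * of_int n * \<i> * of_real pi + (\<Sum>i\<in>{2..l}. of_nat (\<kappa> i) * Ln (\<alpha> i)))
                    / Ln (\<alpha> 1)"

definition gfib_poles :: "nat \<Rightarrow> (nat \<Rightarrow> complex) \<Rightarrow> complex set" where
  "gfib_poles l \<alpha> = {gfib_pole l \<alpha> k \<kappa> n | k \<kappa> n. k = (\<Sum>i\<in>{2..l}. \<kappa> i)}"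

(* gfib_coeff l (\<alpha> 1) is a positive real number, so that powr, being exp (_ * Ln _), is here the
   power taken with the real logarithm. *)
definition gfib_residue ::
    "nat \<Rightarrow> (nat \<Rightarrow> complex) \<Rightarrow> nat \<Rightarrow> (nat \<Rightarrow> nat) \<Rightarrow> int \<Rightarrow> complex" where
  "gfib_residue l \<alpha> k \<kappa> n =
     (let s = gfib_pole l \<alpha> k \<kappa> n; A = gfib_coeff l (\<alpha> 1) in
        A powr (- s) * ((- s) gchoose k) * A powi (- int k)
        * (fact k / (\<Prod>i\<in>{2..l}. fact (\<kappa> i)))
        * (\<Prod>i\<in>{2..l}. gfib_coeff l (\<alpha> i) ^ \<kappa> i)
        * (1 / Ln (\<alpha> 1)))"

end

theory Submission
  imports Defs
begin

text \<open>By the Binet formula, \<open>F n = c * r ^ n * (1 + x n)\<close> where \<open>r = \<alpha> 1\<close> and \<open>x n = O(r ^ (-n))\<close>. Expanding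
  \<open>(1 + x n) powr (- s)\<close> by the binomial series up to order \<open>K\<close> leaves remainders whose sum over \<open>n\<close>
  is holomorphic for \<open>Re s > - K\<close>. The multinomial theorem turns each split-off term into finitely
  many geometric series in \<open>n\<close>, with sums of the form \<open>coeff * w / (1 - w)\<close>, where \<open>w\<close> is an exponential
  function of \<open>s\<close>; these produce the simple poles. For \<open>Re s > - K\<close>, the term of order \<open>K\<close> converges, so
  orders \<open>K\<close> and \<open>K + 1\<close> define the same function and no identity theorem is needed for gluing.

  The residue formula also requires that different exponent vectors never give the same pole.
  Such a coincidence is a multiplicative relation between the roots. As \<open>\<alpha> 1\<close> is a Pisot unit, a Galois
  conjugation moving the largest exponent to \<open>\<alpha> 1\<close> shows that only relations with constant
  exponents exist (Mignotte's argument), and homogeneity excludes these.\<close>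

section \<open>Extending field embeddings into the complex numbers\<close>

text \<open>For a fixed exponent vector \<open>\<kappa>\<close>, the points given by all integers
  \<open>n\<close> are the solutions of the single equation \<open>ratio \<kappa> s = 1\<close>, and
  each vector contributes one closed geometric sum. Two vectors interfere exactly where both ratios
  equal 1; the residue there would be the sum of two of the stated values. Since the ratio is an
  exponential, the choice of logarithms disappears from such a coincidence, and what remains is an
  equation between monomials in the roots. The conjugation applied to this equation is an embedding
  into the complex numbers of a subfield that contains all roots. It is built from the rationals: a
  chosen root is sent to \<open>\<alpha> 1\<close>, then the other roots are adjoined one at a time.
  This is why subfields appear as sets together with a map defined on them. Much about the roots is
  read off from \<open>(x - 1) * \<phi>(x) = x^(l+1) - 2 x^l + 1\<close>, with \<open>\<phi>\<close>
  the characteristic polynomial: \<open>x^l * (2 - x) = 1\<close> at a root, and a derivative whose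
  zeros are 0 and \<open>2l/(l+1)\<close>. The second zero is also that of the denominator in
  \<open>gfib_coeff\<close>.\<close>

definition field_embedding :: "complex set \<Rightarrow> (complex \<Rightarrow> complex) \<Rightarrow> bool" where
  "field_embedding K \<sigma> \<longleftrightarrow>
     1 \<in> K \<and> \<sigma> 1 = 1 \<and>
     (\<forall>x\<in>K. \<forall>y\<in>K. x + y \<in> K \<and> x * y \<in> K \<and> \<sigma> (x + y) = \<sigma> x + \<sigma> y \<and> \<sigma> (x * y) = \<sigma> x * \<sigma> y) \<and>
     (\<forall>x\<in>K. - x \<in> K \<and> inverse x \<in> K)"

text \<open>Polynomials over the subfield stay complex polynomials, so that evaluation, degree and
  divisibility need no change of type.\<close>

definition coeffs_in :: "complex set \<Rightarrow> complex poly \<Rightarrow> bool" where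
  "coeffs_in K p \<longleftrightarrow> (\<forall>i. coeff p i \<in> K)"

context
  fixes K :: "complex set" and \<sigma> :: "complex \<Rightarrow> complex"
  assumes emb: "field_embedding K \<sigma>"
begin

lemma emb_closed:
  "1 \<in> K" "x \<in> K \<Longrightarrow> y \<in> K \<Longrightarrow> x + y \<in> K" "x \<in> K \<Longrightarrow> y \<in> K \<Longrightarrow> x * y \<in> K"
  "x \<in> K \<Longrightarrow> - x \<in> K" "x \<in> K \<Longrightarrow> inverse x \<in> K"
  using emb unfolding field_embedding_def by blast+

lemma emb_hom:
  "\<sigma> 1 = 1" "x \<in> K \<Longrightarrow> y \<in> K \<Longrightarrow> \<sigma> (x + y) = \<sigma> x + \<sigma> y" "x \<in> K \<Longrightarrow> y \<in> K \<Longrightarrow> \<sigma> (x * y) = \<sigma> x * \<sigma> y"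
  using emb unfolding field_embedding_def by blast+

lemma emb_zero: "0 \<in> K" "\<sigma> 0 = 0"
proof -
  show "0 \<in> K" using emb_closed(1) emb_closed(2)[of 1 "-1"] emb_closed(4)[of 1] by simp
  then show "\<sigma> 0 = 0" using emb_hom(2)[of 0 0] by simp
qed

lemma emb_uminus: "x \<in> K \<Longrightarrow> \<sigma> (- x) = - \<sigma> x"
  using emb_hom(2)[of x "- x"] emb_closed(4)[of x] emb_zero by (simp add: eq_neg_iff_add_eq_0 add.commute)

lemma emb_diff: "x \<in> K \<Longrightarrow> y \<in> K \<Longrightarrow> x - y \<in> K"
  using emb_closed(2)[of x "- y"] emb_closed(4)[of y] by simp

lemma emb_sum: "(\<And>i. i \<in> A \<Longrightarrow> f i \<in> K) \<Longrightarrow> sum f A \<in> K \<and> \<sigma> (sum f A) = (\<Sum>i\<in>A. \<sigma> (f i))"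
  by (induction A rule: infinite_finite_induct) (auto simp: emb_zero emb_closed emb_hom)

lemma emb_prod: "(\<And>i. i \<in> A \<Longrightarrow> f i \<in> K) \<Longrightarrow> prod f A \<in> K \<and> \<sigma> (prod f A) = (\<Prod>i\<in>A. \<sigma> (f i))"
  by (induction A rule: infinite_finite_induct) (auto simp: emb_zero emb_closed emb_hom)

lemma emb_power: "x \<in> K \<Longrightarrow> x ^ n \<in> K \<and> \<sigma> (x ^ n) = \<sigma> x ^ n"
  by (induction n) (auto simp: emb_closed emb_hom)

lemma emb_of_int: "of_int n \<in> K \<and> \<sigma> (of_int n) = of_int n"
proof -
  have nat: "of_nat m \<in> K \<and> \<sigma> (of_nat m) = of_nat m" for m
    by (induction m) (auto simp: emb_zero emb_closed emb_hom)
  show ?thesis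
    by (cases n) (use nat emb_closed(4) emb_uminus in \<open>auto simp del: of_nat_Suc\<close>)
qed

lemma emb_nonzero: "x \<in> K \<Longrightarrow> x \<noteq> 0 \<Longrightarrow> \<sigma> x \<noteq> 0"
  using emb_hom(1) emb_hom(3)[of x "inverse x"] emb_closed(5)[of x] by auto

section \<open>Division and minimal polynomials over a subfield\<close>

lemma coeffs_in_intros:
  "coeffs_in K 0" "coeffs_in K 1"
  "coeffs_in K p \<Longrightarrow> coeffs_in K q \<Longrightarrow> coeffs_in K (p + q)"
  "coeffs_in K p \<Longrightarrow> coeffs_in K q \<Longrightarrow> coeffs_in K (p - q)"
  "coeffs_in K p \<Longrightarrow> coeffs_in K q \<Longrightarrow> coeffs_in K (p * q)"
  "coeffs_in K p \<Longrightarrow> coeffs_in K (- p)"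
  "c \<in> K \<Longrightarrow> coeffs_in K (monom c n)"
  by (auto simp: coeffs_in_def emb_zero emb_closed emb_diff coeff_mult emb_sum)

lemma map_poly_emb:
  assumes "coeffs_in K p" "coeffs_in K q"
  shows "map_poly \<sigma> (p + q) = map_poly \<sigma> p + map_poly \<sigma> q"
    and "map_poly \<sigma> (p * q) = map_poly \<sigma> p * map_poly \<sigma> q"
proof -
  note [simp] = coeff_map_poly emb_zero
  have K: "coeff p i \<in> K" "coeff q i \<in> K" for i
    using assms by (auto simp: coeffs_in_def)
  show "map_poly \<sigma> (p + q) = map_poly \<sigma> p + map_poly \<sigma> q"
    by (intro poly_eqI) (simp add: emb_hom K)
  show "map_poly \<sigma> (p * q) = map_poly \<sigma> p * map_poly \<sigma> q"
  proof (rule poly_eqI)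
    fix n
    have "\<sigma> (\<Sum>i\<le>n. coeff p i * coeff q (n - i)) = (\<Sum>i\<le>n. \<sigma> (coeff p i * coeff q (n - i)))"
      using emb_sum[of "{..n}" "\<lambda>i. coeff p i * coeff q (n - i)"] emb_closed(3) K by blast
    then show "coeff (map_poly \<sigma> (p * q)) n = coeff (map_poly \<sigma> p * map_poly \<sigma> q) n"
      by (simp add: coeff_mult emb_hom K)
  qed
qed

lemma map_poly_emb_uminus:
  assumes "coeffs_in K p"
  shows "map_poly \<sigma> (- p) = - map_poly \<sigma> p"
  using assms by (intro poly_eqI) (simp add: coeff_map_poly emb_zero emb_uminus coeffs_in_def)

text \<open>Long division, carried out so as to record that quotient and remainder keep their
  coefficients in \<open>K\<close>.\<close>

lemma emb_poly_division:
  assumes m: "coeffs_in K m" "m \<noteq> 0" and "coeffs_in K p"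
  shows "\<exists>q r. coeffs_in K q \<and> coeffs_in K r \<and> p = q * m + r \<and> (r = 0 \<or> degree r < degree m)"
  using \<open>coeffs_in K p\<close>
\<comment> \<open>The measure places the zero polynomial strictly below the nonzero constants, which
  have the same degree; this matters when \<open>m\<close> is constant.\<close>
proof (induction "if p = 0 then 0 else Suc (degree p)" arbitrary: p rule: less_induct)
  case less
  show ?case
  proof (cases "p = 0 \<or> degree p < degree m")
    case True
    with less.prems show ?thesis
      by (intro exI[of _ 0] exI[of _ p]) (auto simp: coeffs_in_intros)
  next
    case False
    define t where "t = monom (lead_coeff p * inverse (lead_coeff m)) (degree p - degree m)"
    have t: "coeffs_in K t"
      unfolding t_def using m less.prems
      by (intro coeffs_in_intros emb_closed) (auto simp: coeffs_in_def)
    have lead: "degree (t * m) = degree p" "coeff (t * m) (degree p) = lead_coeff p"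
    proof -
      have c: "lead_coeff p * inverse (lead_coeff m) \<noteq> 0"
        using False m by auto
      show d: "degree (t * m) = degree p"
      proof -
        have "t \<noteq> 0" "degree t = degree p - degree m"
          unfolding t_def using c degree_monom_eq[OF c] by (simp_all only: monom_eq_0_iff not_False_eq_True)
        then show ?thesis using False m(2) by (simp add: degree_mult_eq)
      qed
      have "lead_coeff (t * m) = lead_coeff p"
        using m lead_coeff_monom[of "lead_coeff p * inverse (lead_coeff m)" "degree p - degree m"]
        unfolding t_def lead_coeff_mult by simp
      then show "coeff (t * m) (degree p) = lead_coeff p" by (simp add: d)
    qed
    define p' where "p' = p - t * m"
    have p': "coeffs_in K p'"
      unfolding p'_def by (intro coeffs_in_intros t m less.prems)
    have "p' = 0 \<or> degree p' < degree p"
    proof (rule ccontr)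
      assume a: "\<not> ?thesis"
      have "degree p' \<le> degree p"
        unfolding p'_def using lead by (intro degree_diff_le) auto
      with a have "degree p' = degree p" by auto
      then have "lead_coeff p' = 0" by (simp add: p'_def lead)
      with a show False by auto
    qed
    then have "(if p' = 0 then 0 else Suc (degree p')) < (if p = 0 then 0 else Suc (degree p))"
      using False by auto
    from less.hyps[OF this p'] obtain q r where
      "coeffs_in K q" "coeffs_in K r" "p' = q * m + r" "r = 0 \<or> degree r < degree m" by blast
    then show ?thesis
      by (intro exI[of _ "q + t"] exI[of _ r])
         (auto simp: coeffs_in_intros t p'_def algebra_simps)
  qed
qed

lemma emb_minimal_poly:
  assumes "coeffs_in K p" "p \<noteq> 0" "poly p a = 0"
  obtains m where "coeffs_in K m" "m \<noteq> 0" "poly m a = 0" "degree m > 0"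
    "\<And>q. coeffs_in K q \<Longrightarrow> poly q a = 0 \<Longrightarrow> \<exists>u. coeffs_in K u \<and> q = u * m"
    "\<And>q. coeffs_in K q \<Longrightarrow> q \<noteq> 0 \<Longrightarrow> degree q < degree m \<Longrightarrow> poly q a \<noteq> 0"
proof -
  define P where "P = (\<lambda>m. coeffs_in K m \<and> m \<noteq> 0 \<and> poly m a = 0)"
  define m where "m = arg_min degree P"
  have "P m" and min: "\<And>q. P q \<Longrightarrow> degree m \<le> degree q"
    unfolding m_def using assms arg_min_natI[of P p degree] arg_min_nat_le[of P _ degree]
    by (auto simp: P_def)
  then have m: "coeffs_in K m" "m \<noteq> 0" "poly m a = 0" by (auto simp: P_def)
  have small: "poly q a \<noteq> 0" if "coeffs_in K q" "q \<noteq> 0" "degree q < degree m" for q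
    using that min[of q] by (auto simp: P_def)
  have "degree m > 0"
  proof (rule ccontr)
    assume "\<not> degree m > 0"
    then obtain c where "m = [:c:]" by (auto elim: degree_eq_zeroE)
    with m show False by simp
  qed
  moreover have "\<exists>u. coeffs_in K u \<and> q = u * m" if q: "coeffs_in K q" "poly q a = 0" for q
  proof -
    obtain u r where u: "coeffs_in K u" "coeffs_in K r" "q = u * m + r" "r = 0 \<or> degree r < degree m"
      using emb_poly_division[OF m(1,2) q(1)] by blast
    have "poly r a = 0" using q m unfolding u(3) by simp
    with u small[of r] have "r = 0" by auto
    with u show ?thesis by auto
  qed
  ultimately show ?thesis using that m small by blast
qed

section \<open>Simple algebraic extensions\<close>

lemma emb_simple_extension_inverse:
  assumes "coeffs_in K p" "p \<noteq> 0" "poly p a = 0" "coeffs_in K q"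
  shows "\<exists>u. coeffs_in K u \<and> inverse (poly q a) = poly u a"
proof (cases "poly q a = 0")
  case True
  then show ?thesis by (intro exI[of _ 0]) (auto simp: coeffs_in_intros)
next
  case False
  obtain m where m: "coeffs_in K m" "m \<noteq> 0" "poly m a = 0" "degree m > 0"
    "\<And>q. coeffs_in K q \<Longrightarrow> poly q a = 0 \<Longrightarrow> \<exists>u. coeffs_in K u \<and> q = u * m"
    "\<And>q. coeffs_in K q \<Longrightarrow> q \<noteq> 0 \<Longrightarrow> degree q < degree m \<Longrightarrow> poly q a \<noteq> 0"
    using emb_minimal_poly[OF assms(1-3)] by metis
  \<comment> \<open>Descent as in the Euclidean algorithm, but dividing \<open>m\<close> by
    \<open>r\<close>: at \<open>a\<close> the remainder equals minus quotient times
    \<open>r\<close>, so an inverse of the remainder at \<open>a\<close> yields one of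
    \<open>r\<close>. The remainder cannot be zero, as the quotient would then vanish at
    \<open>a\<close> with degree below that of \<open>m\<close>.\<close>
  have *: "\<exists>u. coeffs_in K u \<and> poly r a * poly u a = 1"
    if "coeffs_in K r" "r \<noteq> 0" "degree r < degree m" for r
    using that
  proof (induction "degree r" arbitrary: r rule: less_induct)
    case less
    show ?case
    proof (cases "degree r = 0")
      case True
      then obtain c where c: "r = [:c:]" by (auto elim: degree_eq_zeroE)
      then have "c \<in> K" "c \<noteq> 0" using less.prems by (auto simp: coeffs_in_def dest: spec[of _ 0])
      then have "coeffs_in K (monom (inverse c) 0)" by (intro coeffs_in_intros emb_closed)
      with c \<open>c \<noteq> 0\<close> show ?thesis by (intro exI[of _ "monom (inverse c) 0"]) (auto simp: poly_monom)
    next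
      case False
      obtain v s where v: "coeffs_in K v" "coeffs_in K s" "m = v * r + s" "s = 0 \<or> degree s < degree r"
        using emb_poly_division[OF less.prems(1,2) m(1)] by blast
      have ra: "poly r a \<noteq> 0" using m(6) less.prems by blast
      have eq: "poly v a * poly r a + poly s a = 0"
        using v(3) m(3) by (metis poly_add poly_mult)
      have "s \<noteq> 0"
      proof
        assume "s = 0"
        with eq ra have "poly v a = 0" by simp
        moreover have "v \<noteq> 0" using v m \<open>s = 0\<close> by auto
        moreover have "degree v < degree m"
          using v(3) \<open>s = 0\<close> \<open>v \<noteq> 0\<close> less.prems(2) False by (simp add: degree_mult_eq)
        ultimately show False using m(6) v by blast
      qed
      then obtain u where u: "coeffs_in K u" "poly s a * poly u a = 1"
        using less.hyps[of s] v less.prems by (meson less_trans)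
      have "coeffs_in K (- (v * u))" by (intro coeffs_in_intros u v)
      moreover have "poly r a * poly (- (v * u)) a = 1"
      proof -
        have "poly s a = - (poly v a * poly r a)" using eq by (simp add: eq_neg_iff_add_eq_0 add.commute)
        with u show ?thesis by (simp add: algebra_simps)
      qed
      ultimately show ?thesis by blast
    qed
  qed
  obtain v r where v: "coeffs_in K v" "coeffs_in K r" "q = v * m + r" "r = 0 \<or> degree r < degree m"
    using emb_poly_division[OF m(1,2) assms(4)] by blast
  have r: "poly r a = poly q a" using v m by simp
  with False have "r \<noteq> 0" by auto
  with v(4) have "degree r < degree m" by blast
  from *[OF v(2) \<open>r \<noteq> 0\<close> this] obtain u where "coeffs_in K u" "poly q a * poly u a = 1"
    unfolding r by blast
  then show ?thesis using inverse_unique by blast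
qed

text \<open>The extension field is \<open>K[a]\<close>. The hypothesis on \<open>b\<close> says that
  every relation of \<open>a\<close> over \<open>K\<close> is carried to a relation of
  \<open>b\<close>, which is what makes the value independent of the polynomial representing an
  element.\<close>

lemma emb_simple_extension:
  assumes p: "coeffs_in K p" "p \<noteq> 0" "poly p a = 0"
    and b: "\<And>q. coeffs_in K q \<Longrightarrow> poly q a = 0 \<Longrightarrow> poly (map_poly \<sigma> q) b = 0"
  shows "\<exists>K' \<sigma>'. field_embedding K' \<sigma>' \<and> K \<subseteq> K' \<and> a \<in> K' \<and> \<sigma>' a = b \<and> (\<forall>x\<in>K. \<sigma>' x = \<sigma> x)"
proof -
  define K' where "K' = {poly q a | q. coeffs_in K q}"
  define \<sigma>' where "\<sigma>' = (\<lambda>x. poly (map_poly \<sigma> (SOME q. coeffs_in K q \<and> poly q a = x)) b)"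
  have \<sigma>': "\<sigma>' (poly q a) = poly (map_poly \<sigma> q) b" if q: "coeffs_in K q" for q
  proof -
    define q' where "q' = (SOME r. coeffs_in K r \<and> poly r a = poly q a)"
    have q': "coeffs_in K q'" "poly q' a = poly q a"
      unfolding q'_def using someI[of "\<lambda>r. coeffs_in K r \<and> poly r a = poly q a" q] q by auto
    have "poly (map_poly \<sigma> (q' + - q)) b = 0"
      using q q' by (intro b coeffs_in_intros) auto
    then have "poly (map_poly \<sigma> q') b + - poly (map_poly \<sigma> q) b = 0"
      using q q' by (simp only: map_poly_emb map_poly_emb_uminus coeffs_in_intros poly_add poly_minus)
    then show ?thesis by (simp add: \<sigma>'_def q'_def)
  qed
  have sub: "K \<subseteq> K'"
    unfolding K'_def by (auto intro!: exI[of _ "monom _ 0"] simp: coeffs_in_intros poly_monom)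
  have c: "map_poly \<sigma> (monom c n) = monom (\<sigma> c) n" for c n
    by (intro poly_eqI) (simp add: coeff_map_poly emb_zero)
  have "field_embedding K' \<sigma>'"
    unfolding field_embedding_def
  proof (intro conjI ballI)
    show "1 \<in> K'" using sub emb_closed(1) by blast
    show "\<sigma>' 1 = 1"
      using \<sigma>'[of "monom 1 0"] c[of 1 0] by (simp add: coeffs_in_intros emb_closed poly_monom emb_hom)
  next
    fix x y assume "x \<in> K'" "y \<in> K'"
    then obtain q r where q: "coeffs_in K q" "x = poly q a" "coeffs_in K r" "y = poly r a"
      by (auto simp: K'_def)
    have qr: "coeffs_in K (q + r)" "coeffs_in K (q * r)" using q by (auto intro: coeffs_in_intros)
    have xy: "x + y = poly (q + r) a" "x * y = poly (q * r) a" using q by auto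
    show "x + y \<in> K'" "x * y \<in> K'" using qr xy unfolding K'_def by blast+
    show "\<sigma>' (x + y) = \<sigma>' x + \<sigma>' y" "\<sigma>' (x * y) = \<sigma>' x * \<sigma>' y"
      unfolding xy \<sigma>'[OF qr(1)] \<sigma>'[OF qr(2)] using q by (auto simp: \<sigma>' map_poly_emb)
  next
    fix x assume "x \<in> K'"
    then obtain q where q: "coeffs_in K q" "x = poly q a" by (auto simp: K'_def)
    show "- x \<in> K'" using q coeffs_in_intros(6)[OF q(1)] unfolding K'_def by (auto intro!: exI[of _ "- q"])
    show "inverse x \<in> K'" using emb_simple_extension_inverse[OF p q(1)] q unfolding K'_def by auto
  qed
  moreover have X: "coeffs_in K (monom 1 1)" by (intro coeffs_in_intros emb_closed)
  then have "a \<in> K'" unfolding K'_def by (auto intro!: exI[of _ "monom 1 1"] simp: poly_monom)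
  moreover have "\<sigma>' a = b" using \<sigma>'[OF X] c[of 1 1] by (simp add: poly_monom emb_hom)
  moreover have "\<sigma>' x = \<sigma> x" if "x \<in> K" for x
    using \<sigma>'[of "monom x 0"] c[of x 0] that by (simp add: poly_monom coeffs_in_intros)
  ultimately show ?thesis using sub by blast
qed

text \<open>Since \<open>\<sigma>\<close> kills no nonzero element of \<open>K\<close>, the image of
  the minimal polynomial keeps a positive degree and has a complex root; every other relation of
  \<open>a\<close> is a multiple of the minimal polynomial.\<close>

lemma emb_poly_root:
  assumes p: "coeffs_in K p" "p \<noteq> 0" "poly p a = 0"
  shows "\<exists>b. \<forall>q. coeffs_in K q \<longrightarrow> poly q a = 0 \<longrightarrow> poly (map_poly \<sigma> q) b = 0"
proof -
  obtain m where m: "coeffs_in K m" "m \<noteq> 0" "degree m > 0"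
    "\<And>q. coeffs_in K q \<Longrightarrow> poly q a = 0 \<Longrightarrow> \<exists>u. coeffs_in K u \<and> q = u * m"
    using emb_minimal_poly[OF p] by metis
  have "coeff (map_poly \<sigma> m) (degree m) \<noteq> 0"
    using m emb_nonzero[of "lead_coeff m"] by (simp add: coeff_map_poly emb_zero coeffs_in_def)
  then have "degree (map_poly \<sigma> m) \<ge> degree m" by (rule le_degree)
  then have "degree (map_poly \<sigma> m) > 0" using m(3) by simp
  then have "\<exists>i\<in>{1..degree (map_poly \<sigma> m)}. coeff (map_poly \<sigma> m) i \<noteq> 0"
    by (intro bexI[of _ "degree (map_poly \<sigma> m)"]) (auto simp: leading_coeff_neq_0)
  then obtain b where b: "poly (map_poly \<sigma> m) b = 0"
    unfolding poly_altdef using fundamental_theorem_of_algebra by metis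
  show ?thesis
  proof (intro exI[of _ b] allI impI)
    fix q assume "coeffs_in K q" "poly q a = 0"
    from m(4)[OF this] obtain u where "coeffs_in K u" "q = u * m" by auto
    then show "poly (map_poly \<sigma> q) b = 0" using m(1) b by (simp add: map_poly_emb)
  qed
qed

end

text \<open>Algebraicity is required over the integers because these lie in every intermediate
  field, so that the hypothesis survives each adjunction.\<close>

lemma field_embedding_extend:
  assumes "field_embedding K \<sigma>" "finite S"
    and "\<And>a. a \<in> S \<Longrightarrow> \<exists>p. (\<forall>i. coeff p i \<in> \<int>) \<and> p \<noteq> 0 \<and> poly p a = 0"
  shows "\<exists>K' \<sigma>'. field_embedding K' \<sigma>' \<and> K \<union> S \<subseteq> K' \<and> (\<forall>x\<in>K. \<sigma>' x = \<sigma> x)"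
  using assms(2,3)
proof (induction S rule: finite_induct)
  case empty
  then show ?case using assms by auto
next
  case (insert a S)
  then obtain K' \<sigma>' where K': "field_embedding K' \<sigma>'" "K \<union> S \<subseteq> K'" "\<forall>x\<in>K. \<sigma>' x = \<sigma> x" by auto
  obtain p where p: "\<forall>i. coeff p i \<in> \<int>" "p \<noteq> 0" "poly p a = 0" using insert.prems by blast
  have pK: "coeffs_in K' p"
    using p(1) emb_of_int[OF K'(1)] unfolding coeffs_in_def by (metis Ints_cases)
  obtain b where b: "\<forall>q. coeffs_in K' q \<longrightarrow> poly q a = 0 \<longrightarrow> poly (map_poly \<sigma>' q) b = 0"
    using emb_poly_root[OF K'(1) pK p(2,3)] by blast
  obtain K'' \<sigma>'' where "field_embedding K'' \<sigma>''" "K' \<subseteq> K''" "a \<in> K''" "\<forall>x\<in>K'. \<sigma>'' x = \<sigma>' x"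
    using emb_simple_extension[OF K'(1) pK p(2,3), of b] b by blast
  then show ?case using K' by (intro exI[of _ K''] exI[of _ \<sigma>'']) auto
qed

section \<open>Location of the roots of the characteristic polynomial\<close>

text \<open>With \<open>t = x - 1\<close>, Bernoulli's inequality bounds the left side below by
  \<open>(1 + l t)(1 - t) = 1 + t (l - 1 - l t)\<close>. Hence the root equation
  \<open>x^l * (2 - x) = 1\<close> has no real solution strictly between 1 and
  \<open>2 - 1/l\<close>.\<close>

lemma bernoulli_gap:
  fixes x :: real
  assumes "1 < x" "real l * (x - 1) < real l - 1"
  shows "x ^ l * (2 - x) > 1"
proof -
  define t where "t = x - 1"
  have l: "real l > 1" using assms by (smt (verit) mult_nonneg_nonneg of_nat_0_le_iff)
  have "t < 1"
  proof (rule ccontr)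
    assume "\<not> t < 1"
    then have "real l * t \<ge> real l" using l by simp
    then show False using assms unfolding t_def by linarith
  qed
  have t: "t > 0" "real l * t < real l - 1" using assms by (auto simp: t_def)
  then have "0 < t * (real l - 1 - real l * t)" by (intro mult_pos_pos) auto
  then have "1 < (1 + real l * t) * (1 - t)" by (simp add: algebra_simps)
  also have "\<dots> \<le> (1 + t) ^ l * (1 - t)"
    using t \<open>t < 1\<close> by (intro mult_right_mono Bernoulli_inequality) auto
  finally show ?thesis by (simp add: t_def)
qed

text \<open>After division by \<open>x^l\<close> the equation equates 1 with a sum of positive
  powers of \<open>1/x\<close>, which is strictly decreasing in \<open>x\<close>.\<close>

lemma geometric_root_unique:
  fixes r s :: real
  assumes "r > 0" "s > 0" "r ^ l = (\<Sum>j<l. r ^ j)" "s ^ l = (\<Sum>j<l. s ^ j)"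
  shows "r = s"
proof -
  have *: False if "0 < r" "r < s" "r ^ l = (\<Sum>j<l. r ^ j)" "s ^ l = (\<Sum>j<l. s ^ j)" for r s :: real
  proof -
    have l: "l \<noteq> 0" using that by (intro notI) simp
    have eq: "1 = (\<Sum>j<l. (1 / x) ^ (l - j))" if "x > 0" "x ^ l = (\<Sum>j<l. x ^ j)" for x :: real
    proof -
      have "1 = (\<Sum>j<l. x ^ j) / x ^ l" using that by (metis div_self power_not_zero less_irrefl)
      also have "\<dots> = (\<Sum>j<l. (1 / x) ^ (l - j))"
        unfolding sum_divide_distrib using that
        by (intro sum.cong) (auto simp: power_diff power_one_over divide_simps)
      finally show ?thesis .
    qed
    have "(\<Sum>j<l. (1 / s) ^ (l - j)) < (\<Sum>j<l. (1 / r) ^ (l - j))"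
      using that l by (intro sum_strict_mono power_strict_mono) (auto simp: field_simps)
    with eq[of r] eq[of s] that show False by auto
  qed
  show ?thesis using *[of r s] *[of s r] assms by (metis linorder_less_linear)
qed

lemma gfib_poly_telescope:
  "[:-1, 1:] * gfib_poly l = monom 1 (Suc l) - monom 2 l + 1"
proof -
  have "(x - 1) * (x ^ l - (\<Sum>j<l. x ^ j)) = x ^ Suc l - 2 * x ^ l + 1" for x :: complex
    using power_diff_1_eq[of x l] by (simp add: algebra_simps)
  then show ?thesis
    by (simp add: poly_eq_poly_eq_iff[symmetric] fun_eq_iff gfib_poly_def poly_sum poly_monom algebra_simps)
qed

lemma poly_gfib_poly: "poly (gfib_poly l) x = x ^ l - (\<Sum>j<l. x ^ j)"
  by (simp add: gfib_poly_def poly_sum poly_monom)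

text \<open>With \<open>r = cmod z\<close>, the triangle inequality in \<open>z ^ l = (\<Sum>j<l. z ^ j)\<close> and the one in
  \<open>z ^ l * (2 - z) = 1\<close> give opposite inequalities for \<open>r\<close>, so both are equalities, which forces
  \<open>z\<close> to be real and positive.\<close>

lemma gfib_poly_root_outside:
  assumes "l \<ge> 2" "poly (gfib_poly l) z = 0" "cmod z \<ge> 1"
  shows "z = of_real (cmod z)" "cmod z > 1" "cmod z ^ l = (\<Sum>j<l. cmod z ^ j)"
proof -
  define r where "r = cmod z"
  have zl: "z ^ l = (\<Sum>j<l. z ^ j)" using assms(2) by (simp add: poly_gfib_poly)
  have "z \<noteq> 1" using zl assms(1) by auto
  have "poly ([:-1, 1:] * gfib_poly l) z = 0" using assms(2) by simp
  then have "z ^ l * (2 - z) = 1"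
    unfolding gfib_poly_telescope by (simp add: poly_monom algebra_simps)
  then have eq: "r ^ l * cmod (2 - z) = 1"
    unfolding r_def by (metis norm_mult norm_one norm_power)
  have sq: "r ^ 2 = Re z ^ 2 + Im z ^ 2" "cmod (2 - z) ^ 2 = (2 - Re z) ^ 2 + Im z ^ 2"
    by (simp_all add: r_def cmod_power2)
  \<comment> \<open>On the unit circle the root equation also gives distance 1 from 2, and the two
    circles touch only at 1.\<close>
  have "r \<noteq> 1"
  proof
    assume r: "r = 1"
    with eq have "cmod (2 - z) = 1" by simp
    with sq r have "Re z = 1" "Im z = 0" by (auto simp: power2_eq_square algebra_simps)
    with \<open>z \<noteq> 1\<close> show False by (simp add: complex_eq_iff)
  qed
  with assms(3) show r1: "cmod z > 1" by (simp add: r_def)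
  have le: "r ^ l \<le> (\<Sum>j<l. r ^ j)"
    using norm_sum[of "\<lambda>j. z ^ j" "{..<l}"] zl[symmetric] by (simp add: norm_power r_def)
  have tel: "(r - 1) * (r ^ l - (\<Sum>j<l. r ^ j)) = 1 - r ^ l * (2 - r)"
    using power_diff_1_eq[of r l] by (simp add: algebra_simps)
  have "(r - 1) * (r ^ l - (\<Sum>j<l. r ^ j)) \<le> 0"
    using le r1 by (intro mult_nonneg_nonpos) (auto simp: r_def)
  then have "r ^ l * cmod (2 - z) \<le> r ^ l * (2 - r)" unfolding eq tel by simp
  moreover have rl: "r ^ l > 0" using r1 unfolding r_def by (intro zero_less_power) linarith
  ultimately have c: "cmod (2 - z) \<le> 2 - r" by simp
  then have "cmod (2 - z) ^ 2 \<le> (2 - r) ^ 2" by (intro power_mono) auto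
  then have "r \<le> Re z" using sq by (simp add: power2_eq_square algebra_simps)
  then have "Re z = r" using complex_Re_le_cmod[of z] by (simp add: r_def)
  moreover from this have "Im z = 0" using sq by simp
  ultimately show z: "z = of_real (cmod z)" by (simp add: complex_eq_iff r_def)
  have "complex_of_real (cmod z ^ l) = complex_of_real (\<Sum>j<l. cmod z ^ j)"
    using zl z by (metis (no_types, lifting) of_real_power of_real_sum sum.cong)
  then show "cmod z ^ l = (\<Sum>j<l. cmod z ^ j)" by (simp only: of_real_eq_iff)
qed

section \<open>Simplicity, size and product of the roots\<close>

locale gfib_root_list =
  fixes l :: nat and \<alpha> :: "nat \<Rightarrow> complex"
  assumes l_ge_2: "l \<ge> 2" and gfib_roots: "gfib_roots l \<alpha>"
begin

lemma gfib_poly_prod: "gfib_poly l = (\<Prod>i\<in>{1..l}. [:- \<alpha> i, 1:])"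
  using gfib_roots by (simp add: gfib_roots_def)

lemma poly_gfib_poly_eq_0_iff: "poly (gfib_poly l) x = 0 \<longleftrightarrow> x \<in> \<alpha> ` {1..l}"
  by (auto simp: gfib_poly_prod poly_prod prod_zero_iff)

lemma root_equation:
  assumes "i \<in> {1..l}"
  shows "\<alpha> i ^ l * (2 - \<alpha> i) = 1" "\<alpha> i \<noteq> 0" "\<alpha> i \<noteq> 1"
proof -
  have z: "poly (gfib_poly l) (\<alpha> i) = 0" using assms poly_gfib_poly_eq_0_iff by blast
  then have "poly ([:-1, 1:] * gfib_poly l) (\<alpha> i) = 0" by simp
  then show "\<alpha> i ^ l * (2 - \<alpha> i) = 1"
    unfolding gfib_poly_telescope by (simp add: poly_monom algebra_simps)
  then show "\<alpha> i \<noteq> 0" using l_ge_2 by (intro notI) (simp add: power_0_left)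
  show "\<alpha> i \<noteq> 1" using z l_ge_2 by (intro notI) (simp add: poly_gfib_poly)
qed

text \<open>The excluded value \<open>2l/(l+1)\<close> is the nonzero critical point of
  \<open>x^(l+1) - 2 x^l + 1\<close>. It is real and lies in the range of
  \<open>bernoulli_gap\<close>, so it violates the root equation. This yields both the simplicity of
  the roots and the nonvanishing of the denominators in the Binet formula.\<close>

lemma root_ne_critical:
  assumes "i \<in> {1..l}"
  shows "(of_nat l + 1) * \<alpha> i \<noteq> 2 * of_nat l"
proof
  assume "(of_nat l + 1) * \<alpha> i = 2 * of_nat l"
  moreover have l1: "(of_nat l + 1 :: complex) \<noteq> 0"
    using of_nat_neq_0[of l, where 'a = complex] by (simp add: add.commute)
  ultimately have a: "\<alpha> i = of_real (2 * real l / (real l + 1))"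
    using l1 by (simp add: field_simps)
  define x where "x = 2 * real l / (real l + 1)"
  have "complex_of_real (x ^ l * (2 - x)) = of_real 1"
    using root_equation(1)[OF assms] unfolding a x_def[symmetric] by simp
  then have "x ^ l * (2 - x) = 1" by (simp only: of_real_eq_iff)
  moreover have "x ^ l * (2 - x) > 1"
  proof (rule bernoulli_gap)
    have l: "real l \<ge> 2" using l_ge_2 by simp
    show "1 < x" using l by (simp add: x_def field_simps)
    have "x - 1 = (real l - 1) / (real l + 1)" using l by (simp add: x_def field_simps)
    then have "real l * (x - 1) = (real l - 1) * (real l / (real l + 1))" by simp
    also have "\<dots> < (real l - 1) * 1" using l by (intro mult_strict_left_mono) (auto simp: field_simps)
    finally show "real l * (x - 1) < real l - 1" by simp
  qed
  ultimately show False by simp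
qed

lemma pderiv_gfib_poly_root:
  assumes "i \<in> {1..l}"
  shows "poly (pderiv (gfib_poly l)) (\<alpha> i) * (\<alpha> i - 1) = \<alpha> i ^ (l - 1) * ((of_nat l + 1) * \<alpha> i - 2 * of_nat l)"
proof -
  have z: "poly (gfib_poly l) (\<alpha> i) = 0" using assms poly_gfib_poly_eq_0_iff by blast
  have "poly (pderiv ([:-1, 1:] * gfib_poly l)) (\<alpha> i) = poly (pderiv (gfib_poly l)) (\<alpha> i) * (\<alpha> i - 1)"
    unfolding pderiv_mult by (simp add: z pderiv_pCons algebra_simps)
  moreover have "\<alpha> i ^ l = \<alpha> i ^ (l - 1) * \<alpha> i"
    using l_ge_2 by (metis One_nat_def Suc_diff_le diff_Suc_Suc less_eq_Suc_le minus_nat.diff_0 numeral_2_eq_2 power_Suc2 Suc_leD)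
  ultimately show ?thesis
    unfolding gfib_poly_telescope
    by (simp add: pderiv_add pderiv_diff pderiv_monom poly_monom algebra_simps pderiv_1)
qed

lemma pderiv_gfib_poly_prod:
  assumes "i \<in> {1..l}"
  shows "poly (pderiv (gfib_poly l)) (\<alpha> i) = (\<Prod>j\<in>{1..l} - {i}. \<alpha> i - \<alpha> j)"
proof -
  have "gfib_poly l = [:- \<alpha> i, 1:] * (\<Prod>j\<in>{1..l} - {i}. [:- \<alpha> j, 1:])"
    unfolding gfib_poly_prod using assms by (subst prod.remove[of _ i]) auto
  then have "pderiv (gfib_poly l) = [:- \<alpha> i, 1:] * pderiv (\<Prod>j\<in>{1..l} - {i}. [:- \<alpha> j, 1:])
      + (\<Prod>j\<in>{1..l} - {i}. [:- \<alpha> j, 1:])"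
    by (simp only: pderiv_mult pderiv_pCons) simp
  then show ?thesis by (simp only: poly_add poly_mult poly_prod) simp
qed

lemma pderiv_gfib_poly_nonzero:
  assumes "i \<in> {1..l}"
  shows "poly (pderiv (gfib_poly l)) (\<alpha> i) \<noteq> 0"
  using pderiv_gfib_poly_root[OF assms] root_ne_critical[OF assms] root_equation(2)[OF assms]
  by auto

lemma inj_roots: "inj_on \<alpha> {1..l}"
proof (rule inj_onI, rule ccontr)
  fix i j assume "i \<in> {1..l}" "j \<in> {1..l}" "\<alpha> i = \<alpha> j" "i \<noteq> j"
  then have "(\<Prod>k\<in>{1..l} - {i}. \<alpha> i - \<alpha> k) = 0" by (subst prod_zero_iff) auto
  with pderiv_gfib_poly_nonzero[OF \<open>i \<in> _\<close>] pderiv_gfib_poly_prod[OF \<open>i \<in> _\<close>] show False by simp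
qed

definition r :: real where "r = cmod (\<alpha> 1)"

lemma one_index: "1 \<in> {1..l}" using l_ge_2 by simp

lemma dominant_root: "\<alpha> 1 = of_real r" "r > 1" "r ^ l = (\<Sum>j<l. r ^ j)"
  using gfib_poly_root_outside[of l "\<alpha> 1"] gfib_roots l_ge_2 poly_gfib_poly_eq_0_iff[of "\<alpha> 1"] one_index
  unfolding r_def gfib_roots_def by (metis imageI less_imp_le)+

text \<open>\<open>bernoulli_gap\<close> forces \<open>l * r \<ge> 2 * l - 1\<close>, and adding
  \<open>r > 1\<close> makes the inequality strict. It is the positivity of the denominator in the
  dominant Binet coefficient.\<close>

lemma dominant_root_large: "(real l + 1) * r > 2 * real l"
proof -
  have "complex_of_real (r ^ l * (2 - r)) = of_real 1"
    using root_equation(1)[OF one_index] unfolding dominant_root(1) by simp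
  then have eq: "r ^ l * (2 - r) = 1" by (simp only: of_real_eq_iff)
  then have "\<not> real l * (r - 1) < real l - 1" using bernoulli_gap[OF dominant_root(2), of l] by auto
  then have a: "real l * r \<ge> 2 * real l - 1" by (simp add: algebra_simps)
  then show ?thesis using dominant_root(2) by (simp add: algebra_simps)
qed

lemma other_roots:
  assumes "i \<in> {1..l}" "i \<noteq> 1"
  shows "cmod (\<alpha> i) < 1"
proof (rule ccontr)
  assume a: "\<not> ?thesis"
  have "poly (gfib_poly l) (\<alpha> i) = 0" using assms poly_gfib_poly_eq_0_iff by blast
  from gfib_poly_root_outside[OF l_ge_2 this] a
  have *: "\<alpha> i = of_real (cmod (\<alpha> i))" "cmod (\<alpha> i) > 1" "cmod (\<alpha> i) ^ l = (\<Sum>j<l. cmod (\<alpha> i) ^ j)" by auto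
  have "cmod (\<alpha> i) = r"
    using dominant_root(2) *(2) by (intro geometric_root_unique[OF _ _ *(3) dominant_root(3)]) linarith+
  then have "\<alpha> i = \<alpha> 1" using *(1) dominant_root(1) by metis
  with inj_roots assms one_index show False by (auto dest: inj_onD)
qed

lemma Ln_dominant_root: "Ln (\<alpha> 1) = of_real (ln r)" "ln r > 0"
  using dominant_root by (auto simp: Ln_of_real)

text \<open>The constant coefficient is -1, so the product of the roots has modulus 1:
  \<open>\<alpha> 1\<close> is a unit.\<close>

lemma sum_ln_roots: "(\<Sum>i\<in>{1..l}. ln (cmod (\<alpha> i))) = 0"
proof -
  have "poly (gfib_poly l) 0 = (\<Prod>i\<in>{1..l}. - \<alpha> i)"
    unfolding gfib_poly_prod poly_prod by simp
  moreover have "poly (gfib_poly l) 0 = -1"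
    using l_ge_2 by (simp add: poly_gfib_poly power_0_left sum.delta' if_distrib)
  ultimately have "cmod (\<Prod>i\<in>{1..l}. - \<alpha> i) = 1"
    by (metis norm_minus_cancel norm_one)
  then have "(\<Prod>i\<in>{1..l}. cmod (\<alpha> i)) = 1" by (simp add: prod_norm[symmetric])
  then have "ln (\<Prod>i\<in>{1..l}. cmod (\<alpha> i)) = 0" by simp
  then show ?thesis using root_equation(2) by (subst (asm) ln_prod) auto
qed

end

section \<open>Multiplicative independence of the roots\<close>

lemma monic_dvd_linear_product:
  fixes m :: "complex poly"
  assumes "finite S" "lead_coeff m = 1" "m dvd (\<Prod>i\<in>S. [:- \<alpha> i, 1:])"
  shows "\<exists>T\<subseteq>S. m = (\<Prod>i\<in>T. [:- \<alpha> i, 1:])"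
  using assms
proof (induction S arbitrary: m rule: finite_induct)
  case empty
  then show ?case by (auto simp: is_unit_poly_iff)
next
  case (insert i S)
  let ?P = "\<Prod>i\<in>S. [:- \<alpha> i, 1:]" and ?X = "[:- \<alpha> i, 1:]"
  obtain u where u: "?X * ?P = m * u"
    using insert.prems(2) insert.hyps unfolding dvd_def by auto
  \<comment> \<open>The linear factor of the new index belongs either to \<open>m\<close> or to its
    cofactor; cancel it on the side where it occurs.\<close>
  have "poly m (\<alpha> i) * poly u (\<alpha> i) = 0"
    using arg_cong[OF u, of "\<lambda>p. poly p (\<alpha> i)"] by simp
  then consider "poly m (\<alpha> i) = 0" | "poly u (\<alpha> i) = 0" by auto
  then show ?case
  proof cases
    case 1
    then obtain m' where m': "m = ?X * m'" unfolding poly_eq_0_iff_dvd by (elim dvdE)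
    have "?X * ?P = ?X * (m' * u)" using u m' by (simp only: mult.assoc)
    then have P: "?P = m' * u" by (subst (asm) mult_cancel_left) auto
    have "lead_coeff m' = 1"
      using insert.prems(1) unfolding m' lead_coeff_mult by simp
    then obtain T where T: "T \<subseteq> S" "m' = (\<Prod>i\<in>T. [:- \<alpha> i, 1:])"
      using insert.IH[of m'] unfolding P by auto
    then have "finite T" "i \<notin> T" using insert.hyps finite_subset by auto
    then have "m = (\<Prod>i\<in>insert i T. [:- \<alpha> i, 1:])" unfolding m' T(2) by (subst prod.insert) auto
    with T(1) show ?thesis by blast
  next
    case 2
    then obtain u' where u': "u = ?X * u'" unfolding poly_eq_0_iff_dvd by (elim dvdE)
    have "?X * ?P = ?X * (m * u')" using u u' by (simp only: mult.left_commute)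
    then have P: "?P = m * u'" by (subst (asm) mult_cancel_left) auto
    then obtain T where "T \<subseteq> S" "m = (\<Prod>i\<in>T. [:- \<alpha> i, 1:])"
      using insert.IH[of m] insert.prems(1) by auto
    then show ?thesis by auto
  qed
qed

lemma clear_denominators:
  assumes "coeffs_in \<rat> p"
  shows "\<exists>a P. a > 0 \<and> map_poly of_int P = smult (of_int a) p"
  using assms
proof (induction p)
  case 0
  show ?case by (intro exI[of _ 1] exI[of _ 0]) simp
next
  case (pCons c p)
  have "coeffs_in \<rat> p" "c \<in> \<rat>"
    using pCons.prems unfolding coeffs_in_def by (metis coeff_pCons_Suc, metis coeff_pCons_0)
  then obtain a P n d where *: "a > 0" "map_poly of_int P = smult (of_int a) p" "d > 0" "c = of_int n / of_int d"
    using pCons.IH by (metis Rats_cases')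
  have "map_poly of_int (pCons (n * a) (smult d P)) = smult (of_int (a * d)) (pCons c p)"
  proof (rule poly_eqI)
    fix i
    have "complex_of_int (coeff P k) = of_int a * coeff p k" for k
      using arg_cong[OF *(2), of "\<lambda>q. coeff q k"] by (simp add: coeff_map_poly)
    then show "coeff (map_poly of_int (pCons (n * a) (smult d P))) i = coeff (smult (of_int (a * d)) (pCons c p)) i"
      using * by (cases i) (auto simp: coeff_map_poly)
  qed
  with * show ?case by (intro exI[of _ "a * d"] exI[of _ "pCons (n * a) (smult d P)"]) auto
qed

text \<open>Gauss's lemma by contents. With \<open>a m\<close> and \<open>b u\<close> integral, the
  contents multiply to \<open>a b\<close> because \<open>F\<close> is primitive; each divides the
  leading coefficient \<open>a\<close> or \<open>b\<close>, so both are equalities and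
  \<open>a\<close> divides every coefficient of \<open>a m\<close>.\<close>

lemma monic_rational_factor_integral:
  fixes m u :: "complex poly" and F :: "int poly"
  assumes "coeffs_in \<rat> m" "coeffs_in \<rat> u" "lead_coeff m = 1" "lead_coeff F = 1"
    and F: "map_poly of_int F = m * u"
  shows "coeff m i \<in> \<int>"
proof -
  note [simp] = coeff_map_poly
  have deg: "degree (map_poly complex_of_int P) = degree P" for P
    by (rule degree_map_poly) auto
  obtain a M where a: "a > 0" and M: "map_poly of_int M = smult (of_int a) m"
    using clear_denominators[OF assms(1)] by blast
  obtain b U where b: "b > 0" and U: "map_poly of_int U = smult (of_int b) u"
    using clear_denominators[OF assms(2)] by blast
  have cM: "of_int (coeff M i) = of_int a * coeff m i" for i
    using arg_cong[OF M, of "\<lambda>q. coeff q i"] by simp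
  have cU: "of_int (coeff U i) = of_int b * coeff u i" for i
    using arg_cong[OF U, of "\<lambda>q. coeff q i"] by simp
  have "lead_coeff (m * u) = 1"
    unfolding F[symmetric] deg using assms(4) by simp
  then have lu: "lead_coeff u = 1" using assms(3) by (simp add: lead_coeff_mult)
  have "complex_of_int (coeff (M * U) k) = of_int (coeff (smult (a * b) F) k)" for k
  proof -
    have "complex_of_int (coeff (M * U) k) = of_int (a * b) * coeff (m * u) k"
      by (simp add: coeff_mult cM cU sum_distrib_left mult_ac)
    then show ?thesis unfolding F[symmetric] by simp
  qed
  then have "M * U = smult (a * b) F" by (intro poly_eqI) (metis of_int_eq_iff)
  then have "content M * content U = \<bar>a * b\<bar> * content F"
    by (metis content_mult content_smult normalize_int_def)
  moreover have "content F dvd lead_coeff F" by (rule content_dvd_coeff)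
  then have "content F = 1" using assms(4)
    by (metis normalize_content normalize_1_iff is_unit_normalize)
  ultimately have cc: "content M * content U = a * b" using a b by simp
  have "content M dvd coeff M (degree m)" "content U dvd coeff U (degree u)"
    by (rule content_dvd_coeff)+
  moreover have "coeff M (degree m) = a" "coeff U (degree u) = b"
    using cM[of "degree m"] cU[of "degree u"] assms(3) lu by simp_all
  ultimately have le: "content M \<le> a" "content U \<le> b" using a b by (auto intro: zdvd_imp_le)
  have "content P \<ge> 0" for P :: "int poly"
    by (metis abs_ge_zero normalize_content normalize_int_def)
  moreover have "content M * content U > 0" using cc a b by simp
  ultimately have pos: "content M > 0" "content U > 0"
    by (metis linorder_not_less mult_eq_0_iff order_le_less)+
  have "content M = a"
  proof (rule ccontr)
    assume "content M \<noteq> a"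
    then have "content M < a" using le by simp
    then have "content M * content U < a * b"
      using le pos by (intro mult_less_le_imp_less) auto
    with cc show False by simp
  qed
  then have "a dvd coeff M i" by (metis content_dvd_coeff)
  then obtain c where "coeff M i = a * c" by (elim dvdE)
  then have "coeff m i = of_int c" using cM[of i] a by simp
  then show ?thesis by simp
qed

lemma field_embedding_Rats: "field_embedding \<rat> (\<lambda>x. x)"
  by (auto simp: field_embedding_def)

section \<open>Conjugation and multiplicative relations\<close>

context gfib_root_list
begin

lemma gfib_poly_Ints: "gfib_poly l = map_poly of_int (monom 1 l - (\<Sum>j<l. monom 1 j))"
  by (intro poly_eqI) (simp add: gfib_poly_def coeff_map_poly coeff_sum if_distrib)

lemma gfib_poly_lead_coeff: "lead_coeff (monom 1 l - (\<Sum>j<l. monom 1 j) :: int poly) = 1"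
proof -
  have "degree (\<Sum>j<l. monom 1 j :: int poly) < l"
    using l_ge_2 by (intro degree_sum_less) (auto simp: degree_monom_eq)
  then have "degree (monom 1 l + - (\<Sum>j<l. monom 1 j) :: int poly) = degree (monom 1 l :: int poly)"
    by (intro degree_add_eq_left) (simp add: degree_monom_eq)
  then show ?thesis by (simp add: coeff_sum degree_monom_eq)
qed

text \<open>The minimal polynomial of \<open>\<alpha> j\<close> has integer coefficients; if \<open>\<alpha> 1\<close> were not among its roots,
  its constant coefficient would be a nonzero integer of absolute value less than 1.\<close>

lemma rational_relation_dominant:
  assumes j: "j \<in> {1..l}" and p: "coeffs_in \<rat> p" "poly p (\<alpha> j) = 0"
  shows "poly p (\<alpha> 1) = 0"
proof -
  note emb = field_embedding_Rats
  have F: "coeffs_in \<rat> (gfib_poly l)"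
    unfolding gfib_poly_Ints coeffs_in_def by (simp add: coeff_map_poly)
  have F0: "poly (gfib_poly l) (\<alpha> j) = 0" using j poly_gfib_poly_eq_0_iff by blast
  have "gfib_poly l \<noteq> 0" unfolding gfib_poly_prod by (auto simp: prod_zero_iff)
  then obtain m0 where m0: "coeffs_in \<rat> m0" "m0 \<noteq> 0" "poly m0 (\<alpha> j) = 0" "degree m0 > 0"
    "\<And>q. coeffs_in \<rat> q \<Longrightarrow> poly q (\<alpha> j) = 0 \<Longrightarrow> \<exists>u. coeffs_in \<rat> u \<and> q = u * m0"
    using emb_minimal_poly[OF emb F _ F0] by metis
  define c where "c = lead_coeff m0"
  have c: "c \<in> \<rat>" "c \<noteq> 0" using m0 by (auto simp: c_def coeffs_in_def)
  define m where "m = smult (inverse c) m0"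
  have m: "coeffs_in \<rat> m" "lead_coeff m = 1" "degree m > 0"
    using m0 c by (auto simp: m_def coeffs_in_def c_def)
  have m_dvd: "\<exists>u. coeffs_in \<rat> u \<and> q = m * u" if q: "coeffs_in \<rat> q" "poly q (\<alpha> j) = 0" for q
  proof -
    obtain u where "coeffs_in \<rat> u" "q = u * m0" using m0(5)[OF q] by auto
    then show ?thesis using c by (intro exI[of _ "smult c u"]) (auto simp: m_def coeffs_in_def)
  qed
  have "poly m (\<alpha> 1) = 0"
  proof (rule ccontr)
    assume m1: "poly m (\<alpha> 1) \<noteq> 0"
    obtain u where u: "coeffs_in \<rat> u" "gfib_poly l = m * u" using m_dvd[OF F F0] by auto
    have int: "coeff m 0 \<in> \<int>"
      by (rule monic_rational_factor_integral[OF m(1) u(1) m(2) gfib_poly_lead_coeff])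
         (use u gfib_poly_Ints in simp)
    have "m dvd (\<Prod>i\<in>{1..l}. [:- \<alpha> i, 1:])"
      using u unfolding gfib_poly_prod[symmetric] by simp
    from monic_dvd_linear_product[OF _ m(2) this] obtain T where
      T: "T \<subseteq> {1..l}" "m = (\<Prod>i\<in>T. [:- \<alpha> i, 1:])" by auto
    have fin: "finite T" using T(1) finite_subset by blast
    have "1 \<notin> T" using m1 fin unfolding T(2) poly_prod by auto
    then have lt: "cmod (\<alpha> i) < 1" if "i \<in> T" for i
      using other_roots[of i] that T(1) by (metis subsetD)
    have c0: "coeff m 0 = (\<Prod>i\<in>T. - \<alpha> i)"
      unfolding poly_0_coeff_0[symmetric] T(2) poly_prod by simp
    obtain t where t: "t \<in> T" using m(3) T(2) by fastforce
    have "cmod (coeff m 0) = cmod (\<alpha> t) * (\<Prod>i\<in>T - {t}. cmod (\<alpha> i))"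
      unfolding c0 prod_norm[symmetric] using prod.remove[OF fin t, of "\<lambda>i. cmod (- \<alpha> i)"] by simp
    also have "\<dots> \<le> cmod (\<alpha> t) * 1"
      by (intro mult_left_mono prod_le_1) (use lt in \<open>auto intro: less_imp_le\<close>)
    also have "\<dots> < 1" using lt t by simp
    finally have "cmod (coeff m 0) < 1" .
    moreover have "coeff m 0 \<noteq> 0"
      unfolding c0 using fin root_equation(2) T(1) by (auto simp: prod_zero_iff)
    ultimately show False using int
      by (auto elim!: Ints_cases)
  qed
  moreover obtain u where "p = m * u" using m_dvd[OF p] by auto
  ultimately show ?thesis by simp
qed

text \<open>The embedding permutes the roots because it is injective and respects their integral
  equation. Writing a relation with natural exponents on both sides avoids negative powers under the
  embedding.\<close>

lemma conjugation:
  assumes j: "j \<in> {1..l}"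
  obtains \<pi> where "bij_betw \<pi> {1..l} {1..l}" "\<pi> j = 1"
    "\<And>a b. (\<Prod>i\<in>{1..l}. \<alpha> i ^ a i) = (\<Prod>i\<in>{1..l}. \<alpha> i ^ b i) \<Longrightarrow>
       (\<Prod>i\<in>{1..l}. \<alpha> (\<pi> i) ^ a i) = (\<Prod>i\<in>{1..l}. \<alpha> (\<pi> i) ^ b i)"
proof -
  note emb = field_embedding_Rats
  have Fi: "\<forall>i. coeff (gfib_poly l) i \<in> \<int>"
    unfolding gfib_poly_Ints coeffs_in_def by (simp add: coeff_map_poly)
  then have F: "coeffs_in \<rat> (gfib_poly l)"
    unfolding coeffs_in_def using Ints_subset_Rats by blast
  have F0: "poly (gfib_poly l) (\<alpha> i) = 0" if "i \<in> {1..l}" for i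
    using that poly_gfib_poly_eq_0_iff by blast
  have Fn: "gfib_poly l \<noteq> 0" unfolding gfib_poly_prod by (auto simp: prod_zero_iff)
  \<comment> \<open>The base embedding is the identity on the rationals, so the condition for
    sending \<open>\<alpha> j\<close> to \<open>\<alpha> 1\<close> is precisely
    \<open>rational_relation_dominant\<close>.\<close>
  obtain K \<sigma> where K: "field_embedding K \<sigma>" "\<alpha> j \<in> K" "\<sigma> (\<alpha> j) = \<alpha> 1"
    using emb_simple_extension[OF emb F Fn F0[OF j], of "\<alpha> 1"] rational_relation_dominant[OF j]
    by (auto simp: map_poly_idI)
  obtain L \<tau> where L: "field_embedding L \<tau>" "\<alpha> ` {1..l} \<subseteq> L" "\<tau> (\<alpha> j) = \<alpha> 1"
    using field_embedding_extend[OF K(1), of "\<alpha> ` {1..l}"] Fi Fn F0 K(2,3) by (metis Un_subset_iff finite_imageI finite_atLeastAtMost imageE)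
  have in_L: "\<alpha> i \<in> L" if "i \<in> {1..l}" for i using L(2) that by blast
  have root: "\<tau> (\<alpha> i) \<in> \<alpha> ` {1..l}" if i: "i \<in> {1..l}" for i
  proof -
    have eq: "\<alpha> i ^ l = (\<Sum>j<l. \<alpha> i ^ j)" using F0[OF i] by (simp add: poly_gfib_poly)
    have "\<tau> (\<alpha> i) ^ l = \<tau> (\<Sum>j<l. \<alpha> i ^ j)"
      unfolding eq[symmetric] using emb_power[OF L(1) in_L[OF i]] by simp
    also have "\<dots> = (\<Sum>j<l. \<tau> (\<alpha> i) ^ j)"
      using emb_sum[OF L(1), of "{..<l}" "\<lambda>j. \<alpha> i ^ j"] emb_power[OF L(1) in_L[OF i]] by simp
    finally show ?thesis unfolding poly_gfib_poly_eq_0_iff[symmetric] poly_gfib_poly by simp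
  qed
  define \<pi> where "\<pi> i = the_inv_into {1..l} \<alpha> (\<tau> (\<alpha> i))" for i
  have \<pi>: "\<pi> i \<in> {1..l}" "\<alpha> (\<pi> i) = \<tau> (\<alpha> i)" if "i \<in> {1..l}" for i
    unfolding \<pi>_def using the_inv_into_into[OF inj_roots root[OF that] order_refl]
      f_the_inv_into_f[OF inj_roots root[OF that]] by blast+
  have inj: "inj_on \<pi> {1..l}"
  proof (rule inj_onI)
    fix i k assume ik: "i \<in> {1..l}" "k \<in> {1..l}" "\<pi> i = \<pi> k"
    then have "\<tau> (\<alpha> i) = \<tau> (\<alpha> k)" using \<pi> by metis
    then have "\<tau> (\<alpha> i + - \<alpha> k) = 0"
      using emb_hom(2)[OF L(1), of "\<alpha> i" "- \<alpha> k"] emb_uminus[OF L(1)] emb_closed(4)[OF L(1)] in_L ik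
      by simp
    moreover have "\<alpha> i + - \<alpha> k \<in> L" by (intro emb_closed(2,4)[OF L(1)] in_L ik)
    ultimately have "\<alpha> i = \<alpha> k" using emb_nonzero[OF L(1), of "\<alpha> i + - \<alpha> k"] by auto
    then show "i = k" using inj_roots ik by (auto dest: inj_onD)
  qed
  have "\<pi> ` {1..l} = {1..l}"
    using inj \<pi>(1) by (intro card_subset_eq) (auto simp: card_image)
  with inj have "bij_betw \<pi> {1..l} {1..l}" by (simp add: bij_betw_def)
  moreover have "\<pi> j = 1"
    unfolding \<pi>_def L(3) using the_inv_into_f_f[OF inj_roots one_index] .
  moreover have "(\<Prod>i\<in>{1..l}. \<alpha> (\<pi> i) ^ a i) = \<tau> (\<Prod>i\<in>{1..l}. \<alpha> i ^ a i)" for a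
  proof -
    have "\<tau> (\<Prod>i\<in>{1..l}. \<alpha> i ^ a i) = (\<Prod>i\<in>{1..l}. \<tau> (\<alpha> i ^ a i))"
      by (intro conjunct2[OF emb_prod[OF L(1)]] conjunct1[OF emb_power[OF L(1)]] in_L)
    also have "\<dots> = (\<Prod>i\<in>{1..l}. \<alpha> (\<pi> i) ^ a i)"
      by (intro prod.cong refl) (metis emb_power[OF L(1) in_L] \<pi>(2))
    finally show ?thesis by simp
  qed
  ultimately show ?thesis using that by metis
qed

text \<open>Conjugate so that an index with maximal exponent difference \<open>d j\<close> is sent to the dominant root,
  and take absolute values: since the logarithms sum to 0, \<open>d j\<close> may be subtracted from every
  exponent, and then all terms have the same sign.\<close>

lemma multiplicative_relation_constant:
  fixes a b :: "nat \<Rightarrow> nat"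
  assumes rel: "(\<Prod>i\<in>{1..l}. \<alpha> i ^ a i) = (\<Prod>i\<in>{1..l}. \<alpha> i ^ b i)"
  shows "\<exists>c::int. \<forall>i\<in>{1..l}. int (a i) - int (b i) = c"
proof -
  define d where "d i = int (a i) - int (b i)" for i
  have fin: "finite (d ` {1..l})" "d ` {1..l} \<noteq> {}" using one_index by auto
  then obtain j where j: "j \<in> {1..l}" "d j = Max (d ` {1..l})" using Max_in by (metis imageE)
  have max: "d i \<le> d j" if "i \<in> {1..l}" for i using j that fin by simp
  obtain \<pi> where \<pi>: "bij_betw \<pi> {1..l} {1..l}" "\<pi> j = 1"
    "(\<Prod>i\<in>{1..l}. \<alpha> (\<pi> i) ^ a i) = (\<Prod>i\<in>{1..l}. \<alpha> (\<pi> i) ^ b i)"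
    using conjugation[OF j(1)] rel by metis
  have \<pi>_in: "\<pi> i \<in> {1..l}" if "i \<in> {1..l}" for i using \<pi>(1) that by (metis bij_betwE)
  define v where "v i = ln (cmod (\<alpha> (\<pi> i)))" for i
  have ln: "ln (cmod (\<Prod>i\<in>{1..l}. \<alpha> (\<pi> i) ^ e i)) = (\<Sum>i\<in>{1..l}. real (e i) * v i)" for e
  proof -
    have "ln (\<Prod>i\<in>{1..l}. cmod (\<alpha> (\<pi> i)) ^ e i) = (\<Sum>i\<in>{1..l}. ln (cmod (\<alpha> (\<pi> i)) ^ e i))"
      using root_equation(2) \<pi>_in by (intro ln_prod) auto
    also have "\<dots> = (\<Sum>i\<in>{1..l}. real (e i) * v i)"
      using root_equation(2) \<pi>_in by (intro sum.cong) (auto simp: v_def ln_realpow)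
    finally show ?thesis by (simp add: prod_norm[symmetric] norm_power)
  qed
  have d_sum: "(\<Sum>i\<in>{1..l}. of_int (d i) * v i) = 0"
    using ln[of a] ln[of b] \<pi>(3) by (simp add: d_def algebra_simps sum_subtractf)
  have v_sum: "(\<Sum>i\<in>{1..l}. v i) = 0"
    using sum.reindex_bij_betw[OF \<pi>(1), of "\<lambda>i. ln (cmod (\<alpha> i))"] sum_ln_roots by (simp add: v_def)
  have "(\<Sum>i\<in>{1..l}. of_int (d i - d j) * v i) = 0"
    using d_sum v_sum by (simp add: left_diff_distrib sum_subtractf sum_distrib_left[symmetric])
  moreover have v_neg: "v i < 0" if "i \<in> {1..l}" "i \<noteq> j" for i
  proof -
    have "\<pi> i \<noteq> 1" using \<pi> that j(1) unfolding bij_betw_def by (metis inj_onD)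
    then show ?thesis
      using other_roots[OF \<pi>_in[OF that(1)]] root_equation(2)[OF \<pi>_in[OF that(1)]] by (simp add: v_def)
  qed
  have nonneg: "of_int (d i - d j) * v i \<ge> 0" if "i \<in> {1..l}" for i
    using max[OF that] v_neg[OF that] by (cases "i = j") (auto intro!: mult_nonpos_nonpos)
  ultimately have "\<forall>i\<in>{1..l}. of_int (d i - d j) * v i = 0"
    using nonneg sum_nonneg_eq_0_iff[of "{1..l}" "\<lambda>i. of_int (d i - d j) * v i"] by blast
  then have "d i = d j" if "i \<in> {1..l}" for i
    using v_neg[of i] that by (cases "i = j") auto
  then show ?thesis by (auto simp: d_def)
qed

end

section \<open>The Binet formula\<close>

text \<open>Compare top coefficients in Lagrange interpolation: each basis numerator is monic of
  degree \<open>card I - 1\<close>. The sum is therefore 0 when \<open>p\<close> has smaller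
  degree.\<close>

lemma lagrange_leading_coeff:
  fixes p :: "'a::field poly"
  assumes "finite I" "inj_on \<alpha> I" "degree p < card I"
  shows "(\<Sum>i\<in>I. poly p (\<alpha> i) / (\<Prod>j\<in>I - {i}. \<alpha> i - \<alpha> j)) = coeff p (card I - 1)"
proof -
  define L where "L i = (\<Prod>j\<in>I - {i}. [:- \<alpha> j, 1:])" for i
  define c where "c i = poly p (\<alpha> i) / (\<Prod>j\<in>I - {i}. \<alpha> i - \<alpha> j)" for i
  define q where "q = (\<Sum>i\<in>I. smult (c i) (L i))"
  have degL: "degree (L i) = card I - 1" if "i \<in> I" for i
    unfolding L_def using that assms(1) by (subst degree_prod_eq_sum_degree) auto
  have coeffL: "coeff (L i) (card I - 1) = 1" if "i \<in> I" for i
    using degL[OF that] lead_coeff_prod[of "\<lambda>j. [:- \<alpha> j, 1:]" "I - {i}"] unfolding L_def by simp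
  have polyL: "poly (L i) (\<alpha> k) = (if i = k then \<Prod>j\<in>I - {k}. \<alpha> k - \<alpha> j else 0)" if "i \<in> I" "k \<in> I" for i k
    unfolding L_def poly_prod using that assms(1) by (auto simp: prod_zero_iff)
  have "poly q (\<alpha> k) = poly p (\<alpha> k)" if k: "k \<in> I" for k
  proof -
    have "(\<Prod>j\<in>I - {k}. \<alpha> k - \<alpha> j) \<noteq> 0"
      using assms(1,2) k by (auto simp: prod_zero_iff dest: inj_onD)
    then have ck: "c k * (\<Prod>j\<in>I - {k}. \<alpha> k - \<alpha> j) = poly p (\<alpha> k)" by (simp add: c_def)
    have "poly q (\<alpha> k) = (\<Sum>i\<in>I. if i = k then c k * (\<Prod>j\<in>I - {k}. \<alpha> k - \<alpha> j) else 0)"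
      unfolding q_def poly_sum using k by (intro sum.cong) (auto simp: polyL)
    then show ?thesis using k assms(1) ck by simp
  qed
  moreover have "degree q \<le> card I - 1"
    unfolding q_def by (intro degree_sum_le assms(1) order_trans[OF degree_smult_le]) (simp add: degL)
  ultimately have "p = q"
    using assms(3) by (intro poly_eqI_degree[of "\<alpha> ` I"]) (auto simp: card_image[OF assms(2)])
  then have "coeff p (card I - 1) = coeff q (card I - 1)" by simp
  also have "\<dots> = (\<Sum>i\<in>I. c i)" unfolding q_def by (simp add: coeff_sum coeffL del: One_nat_def)
  finally show ?thesis by (simp add: c_def)
qed

lemma gfib_nonpos [simp]: "n \<le> 0 \<Longrightarrow> gfib l n = 0"
  by (simp add: gfib.simps)

lemma gfib_1 [simp]: "gfib l 1 = 1"
  by (simp add: gfib.simps)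

lemma gfib_rec: "n \<ge> 2 \<Longrightarrow> gfib l n = (\<Sum>j\<in>{1..l}. gfib l (n - int j))"
  by (simp add: gfib.simps)

lemma gfib_pos:
  assumes "l \<ge> 1"
  shows "gfib l (int (Suc n)) > 0"
proof (induction n)
  case 0
  show ?case using gfib_1[of l] by simp
next
  case (Suc n)
  have "gfib l (int (Suc (Suc n)) - int 1) \<le> (\<Sum>j\<in>{1..l}. gfib l (int (Suc (Suc n)) - int j))"
    using assms by (intro member_le_sum) auto
  then show ?case using Suc gfib_rec[of "int (Suc (Suc n))" l] by simp
qed

context gfib_root_list
begin

text \<open>By partial fractions, the coefficient of \<open>x^(-m-1)\<close> in the expansion of
  \<open>1 / \<phi>(x)\<close> at infinity, with \<open>\<phi>\<close> the characteristic
  polynomial.\<close>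

definition root_power_sum :: "nat \<Rightarrow> complex" where
  "root_power_sum m = (\<Sum>i\<in>{1..l}. \<alpha> i ^ m / poly (pderiv (gfib_poly l)) (\<alpha> i))"

lemma root_power_sum_initial:
  assumes "m < l"
  shows "root_power_sum m = (if m = l - 1 then 1 else 0)"
proof -
  have "root_power_sum m = (\<Sum>i\<in>{1..l}. poly (monom 1 m) (\<alpha> i) / (\<Prod>j\<in>{1..l} - {i}. \<alpha> i - \<alpha> j))"
    unfolding root_power_sum_def
    by (intro sum.cong refl) (simp only: pderiv_gfib_poly_prod poly_monom mult_1)
  also have "\<dots> = coeff (monom 1 m) (card {1..l} - 1)"
    using assms by (intro lagrange_leading_coeff inj_roots) (auto simp: degree_monom_eq)
  finally show ?thesis by simp
qed

lemma root_power_sum_rec: "root_power_sum (m + l) = (\<Sum>j<l. root_power_sum (m + j))"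
proof -
  have "\<alpha> i ^ (m + l) = (\<Sum>j<l. \<alpha> i ^ (m + j))" if "i \<in> {1..l}" for i
  proof -
    have "poly (gfib_poly l) (\<alpha> i) = 0" using that poly_gfib_poly_eq_0_iff by blast
    then have "\<alpha> i ^ l = (\<Sum>j<l. \<alpha> i ^ j)" by (simp add: poly_gfib_poly)
    then show ?thesis by (simp add: power_add sum_distrib_left)
  qed
  then have "root_power_sum (m + l)
      = (\<Sum>i\<in>{1..l}. \<Sum>j<l. \<alpha> i ^ (m + j) / poly (pderiv (gfib_poly l)) (\<alpha> i))"
    unfolding root_power_sum_def by (intro sum.cong refl) (simp add: sum_divide_distrib)
  also have "\<dots> = (\<Sum>j<l. root_power_sum (m + j))"
    unfolding root_power_sum_def by (rule sum.swap)
  finally show ?thesis .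
qed

text \<open>Here \<open>m = 0\<close> corresponds to the index \<open>2 - l\<close>, where the
  sequence begins. The values for \<open>m < l\<close> are the initial block of zeros followed by 1,
  and \<open>m \<ge> l\<close> is the range of the recurrence.\<close>

lemma gfib_eq_root_power_sum: "of_nat (gfib l (int m + 2 - int l)) = root_power_sum m"
proof (induction m rule: less_induct)
  case (less m)
  consider "m < l - 1" | "m = l - 1" | "m \<ge> l" using l_ge_2 by linarith
  then show ?case
  proof cases
    case 1
    then show ?thesis using root_power_sum_initial[of m] by simp
  next
    case 2
    then have "int m + 2 - int l = 1" using l_ge_2 by simp
    then show ?thesis using root_power_sum_initial[of m] 2 l_ge_2 by simp
  next
    case 3
    then obtain d where d: "m = d + l" by (metis le_add_diff_inverse2)
    have "gfib l (int m + 2 - int l) = (\<Sum>j\<in>{1..l}. gfib l (int m + 2 - int l - int j))"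
      using d by (intro gfib_rec) simp
    also have "\<dots> = (\<Sum>j<l. gfib l (int (d + j) + 2 - int l))"
      by (rule sum.reindex_bij_witness[of _ "\<lambda>j. l - j" "\<lambda>j. l - j"])
         (auto simp: d of_nat_diff algebra_simps)
    finally have "complex_of_nat (gfib l (int m + 2 - int l)) = (\<Sum>j<l. root_power_sum (d + j))"
      using less.IH d by (simp del: of_nat_add)
    then show ?thesis unfolding d root_power_sum_rec by simp
  qed
qed

text \<open>The index shift by \<open>l - 2\<close> produces the coefficient
  \<open>x^(l-2) / \<phi>'(x)\<close> at a root \<open>x\<close> of the characteristic polynomial
  \<open>\<phi>\<close>; \<open>pderiv_gfib_poly_root\<close> turns it into
  \<open>gfib_coeff\<close>.\<close>

lemma binet: "of_nat (gfib l (int (Suc n))) = (\<Sum>i\<in>{1..l}. gfib_coeff l (\<alpha> i) * \<alpha> i ^ Suc n)"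
proof -
  have "int (Suc n + (l - 2)) + 2 - int l = int (Suc n)" using l_ge_2 by simp
  then have "of_nat (gfib l (int (Suc n))) = root_power_sum (Suc n + (l - 2))"
    using gfib_eq_root_power_sum[of "Suc n + (l - 2)"] by simp
  also have "\<dots> = (\<Sum>i\<in>{1..l}. gfib_coeff l (\<alpha> i) * \<alpha> i ^ Suc n)"
    unfolding root_power_sum_def
  proof (intro sum.cong refl)
    fix i assume i: "i \<in> {1..l}"
    define x D e where "x = \<alpha> i" "D = poly (pderiv (gfib_poly l)) x" "e = (of_nat l + 1) * x - 2 * of_nat l"
    have nz: "x \<noteq> 0" "D \<noteq> 0" "e \<noteq> 0"
      using root_equation(2)[OF i] pderiv_gfib_poly_nonzero[OF i] root_ne_critical[OF i]
      by (auto simp: x_D_e_def)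
    have "Suc (l - 2) = l - 1" using l_ge_2 by simp
    then have "D * (x - 1) = x * x ^ (l - 2) * e"
      using pderiv_gfib_poly_root[OF i] by (metis x_D_e_def power_Suc)
    moreover have "2 + (of_nat l + 1) * (x - 2) = e" by (simp add: x_D_e_def algebra_simps)
    ultimately have "gfib_coeff l x = x ^ (l - 2) / D"
      unfolding gfib_coeff_def using nz by (simp add: field_simps)
    then show "\<alpha> i ^ (Suc n + (l - 2)) / poly (pderiv (gfib_poly l)) (\<alpha> i) = gfib_coeff l (\<alpha> i) * \<alpha> i ^ Suc n"
      unfolding power_add by (simp add: x_D_e_def)
  qed
  finally show ?thesis .
qed

section \<open>Dominant term and relative error\<close>

definition c :: real where "c = (r - 1) / ((real l + 1) * r - 2 * real l) / r"

lemma dominant_coeff: "gfib_coeff l (\<alpha> 1) = of_real c" "c > 0"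
proof -
  show "c > 0" unfolding c_def using dominant_root(2) dominant_root_large by auto
  have "2 + (of_nat l + 1) * (\<alpha> 1 - 2) = complex_of_real ((real l + 1) * r - 2 * real l)"
    unfolding dominant_root(1) by (simp add: algebra_simps)
  then show "gfib_coeff l (\<alpha> 1) = of_real c"
    unfolding gfib_coeff_def c_def using dominant_root(1) by (simp add: divide_inverse)
qed

definition minor :: "nat \<Rightarrow> complex" where
  "minor n = (\<Sum>i\<in>{2..l}. gfib_coeff l (\<alpha> i) * \<alpha> i ^ n)"

text \<open>Defined from the real quotient rather than from the complex minor roots, so that it is
  real by construction and exceeds -1 as soon as the sequence is positive.\<close>

definition rel_err :: "nat \<Rightarrow> real" where
  "rel_err n = real (gfib l (int n)) / (c * r ^ n) - 1"

lemma rel_err: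
  assumes "n \<ge> 1"
  shows "of_real (rel_err n) = minor n / (of_real c * \<alpha> 1 ^ n)"
    and "rel_err n > -1" and "real (gfib l (int n)) = c * r ^ n * (1 + rel_err n)"
    and "\<bar>rel_err n\<bar> \<le> (\<Sum>i\<in>{2..l}. cmod (gfib_coeff l (\<alpha> i))) / c * (1 / r) ^ n"
proof -
  obtain m where n: "n = Suc m" using assms by (cases n) auto
  have pos: "c * r ^ n > 0" using dominant_coeff dominant_root by simp
  show F: "real (gfib l (int n)) = c * r ^ n * (1 + rel_err n)"
    using pos less_imp_neq[OF pos] unfolding rel_err_def by (simp del: mult_eq_0_iff)
  have "real (gfib l (int n)) > 0" using gfib_pos[of l m] l_ge_2 n by simp
  then have "1 + rel_err n > 0" using F pos by (metis zero_less_mult_pos)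
  then show "rel_err n > -1" by simp
  have "{1..l} = insert 1 {2..l}" using l_ge_2 by auto
  then have "of_nat (gfib l (int n)) = of_real c * \<alpha> 1 ^ n + minor n"
    using binet[of m] unfolding n minor_def dominant_coeff(1)[symmetric] by simp
  then have "complex_of_real (real (gfib l (int n))) = of_real c * \<alpha> 1 ^ n + minor n" by simp
  then have "of_real c * \<alpha> 1 ^ n * (1 + of_real (rel_err n)) = of_real c * \<alpha> 1 ^ n + minor n"
    unfolding F by (simp del: One_nat_def add: dominant_root(1))
  moreover have nz: "of_real c * \<alpha> 1 ^ n \<noteq> 0"
    using dominant_coeff(2) dominant_root(2) by (simp del: One_nat_def add: dominant_root(1))
  ultimately show e: "of_real (rel_err n) = minor n / (of_real c * \<alpha> 1 ^ n)"
    by (simp add: field_simps)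
  have "cmod (minor n) \<le> (\<Sum>i\<in>{2..l}. cmod (gfib_coeff l (\<alpha> i)) * 1)"
    unfolding minor_def
  proof (intro sum_norm_le)
    fix i assume "i \<in> {2..l}"
    then have "cmod (\<alpha> i) < 1" by (intro other_roots) auto
    then show "cmod (gfib_coeff l (\<alpha> i) * \<alpha> i ^ n) \<le> cmod (gfib_coeff l (\<alpha> i)) * 1"
      unfolding norm_mult norm_power by (intro mult_left_mono power_le_one) auto
  qed
  then have m: "cmod (minor n) \<le> (\<Sum>i\<in>{2..l}. cmod (gfib_coeff l (\<alpha> i)))" by simp
  have "\<bar>rel_err n\<bar> = cmod (of_real (rel_err n))" by simp
  also have "\<dots> = cmod (minor n) / (c * r ^ n)"
    unfolding e norm_divide using dominant_coeff(2) dominant_root(2)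
    by (simp del: One_nat_def add: dominant_root(1) norm_mult norm_power)
  also have "\<dots> \<le> (\<Sum>i\<in>{2..l}. cmod (gfib_coeff l (\<alpha> i))) / (c * r ^ n)"
    using m pos by (intro divide_right_mono) auto
  finally show "\<bar>rel_err n\<bar> \<le> (\<Sum>i\<in>{2..l}. cmod (gfib_coeff l (\<alpha> i))) / c * (1 / r) ^ n"
    by (simp add: power_one_over field_simps)
qed

end

section \<open>Multinomial and binomial expansions\<close>

text \<open>Vanishing outside \<open>A\<close> makes each exponent vector a unique function, so that
  the set is finite and can index a sum.\<close>

definition multi_indices :: "'a set \<Rightarrow> nat \<Rightarrow> ('a \<Rightarrow> nat) set" where
  "multi_indices A k = {\<kappa>. (\<forall>i. i \<notin> A \<longrightarrow> \<kappa> i = 0) \<and> sum \<kappa> A = k}"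

lemma finite_multi_indices:
  assumes "finite A"
  shows "finite (multi_indices A k)"
proof (rule finite_subset)
  show "multi_indices A k \<subseteq> {f. \<forall>x. (x \<in> A \<longrightarrow> f x \<in> {..k}) \<and> (x \<notin> A \<longrightarrow> f x = 0)}"
    using assms by (auto simp: multi_indices_def intro: member_le_sum)
  show "finite {f. \<forall>x. (x \<in> A \<longrightarrow> f x \<in> {..k}) \<and> (x \<notin> A \<longrightarrow> f x = (0::nat))}"
    using assms by (intro finite_set_of_finite_funs) auto
qed

text \<open>Dividing by \<open>fact k\<close> turns the multinomial coefficient into a product over
  the index set, which lets the induction split off one variable by the binomial theorem.\<close>

lemma multinomial_theorem:
  fixes x :: "'a \<Rightarrow> 'b::field_char_0"
  assumes "finite A"
  shows "(\<Sum>i\<in>A. x i) ^ k / fact k = (\<Sum>\<kappa>\<in>multi_indices A k. \<Prod>i\<in>A. x i ^ \<kappa> i / fact (\<kappa> i))"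
  using assms
proof (induction A arbitrary: k rule: finite_induct)
  case empty
  have "multi_indices {} k = (if k = 0 then {\<lambda>_::'a. 0} else {})"
    by (auto simp: multi_indices_def)
  then show ?case by simp
next
  case (insert a A)
  let ?t = "\<lambda>A \<kappa>. \<Prod>i\<in>A. x i ^ \<kappa> i / fact (\<kappa> i)"
  have cong: "(\<Prod>i\<in>A. x i ^ (if i = a then j else \<kappa> i) / fact (if i = a then j else \<kappa> i)) = ?t A \<kappa>" for \<kappa> j
    using insert.hyps by (intro prod.cong) auto
  have sumcong: "(\<Sum>i\<in>A. if i = a then j else \<kappa> i) = sum \<kappa> A" for \<kappa> :: "'a \<Rightarrow> nat" and j
    using insert.hyps by (intro sum.cong) auto
  have "(\<Sum>i\<in>insert a A. x i) ^ k / fact k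
      = (\<Sum>j\<le>k. of_nat (k choose j) * x a ^ j * (\<Sum>i\<in>A. x i) ^ (k - j)) / fact k"
    using insert.hyps by (simp add: binomial_ring)
  also have "\<dots> = (\<Sum>j\<le>k. x a ^ j / fact j * ((\<Sum>i\<in>A. x i) ^ (k - j) / fact (k - j)))"
    unfolding sum_divide_distrib by (intro sum.cong) (auto simp: binomial_fact)
  also have "\<dots> = (\<Sum>j\<le>k. \<Sum>\<kappa>\<in>multi_indices A (k - j). x a ^ j / fact j * ?t A \<kappa>)"
    unfolding insert.IH sum_distrib_left ..
  also have "\<dots> = (\<Sum>(j, \<kappa>)\<in>Sigma {..k} (\<lambda>j. multi_indices A (k - j)). x a ^ j / fact j * ?t A \<kappa>)"
    by (intro sum.Sigma) (auto simp: finite_multi_indices insert.hyps)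
  also have "\<dots> = (\<Sum>\<kappa>\<in>multi_indices (insert a A) k. ?t (insert a A) \<kappa>)"
  proof (rule sum.reindex_bij_witness[of _ "\<lambda>\<kappa>. (\<kappa> a, \<kappa>(a := 0))" "\<lambda>(j, \<kappa>). \<kappa>(a := j)"], goal_cases)
    case (1 p)
    then show ?case using insert.hyps by (auto simp: multi_indices_def fun_eq_iff)
  next
    case (2 p)
    then show ?case using insert.hyps by (auto simp: multi_indices_def sumcong)
  next
    case (3 \<kappa>)
    then show ?case by simp
  next
    case (4 \<kappa>)
    then show ?case using insert.hyps by (auto simp: multi_indices_def sumcong)
  next
    case (5 p)
    then show ?case using insert.hyps by (auto simp: cong)
  qed
  finally show ?case .
qed

section \<open>Remainders of the binomial series, uniformly in the exponent\<close>

lemma norm_gbinomial_le: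
  fixes s :: complex
  assumes "norm s \<le> R"
  shows "norm (s gchoose k) \<le> pochhammer R k / fact k"
proof -
  have "norm (pochhammer (- s) k) \<le> pochhammer R k"
    unfolding pochhammer_prod prod_norm[symmetric]
  proof (intro prod_mono conjI norm_ge_zero)
    fix i
    show "norm (- s + of_nat i) \<le> R + of_nat i"
      using norm_triangle_ineq[of "- s" "of_nat i"] assms by simp
  qed
  then show ?thesis
    by (simp add: gbinomial_pochhammer norm_mult norm_divide norm_power divide_right_mono)
qed

text \<open>Up to the shift by \<open>K\<close>, this is the binomial series of
  \<open>(1 - 1/2) powr (- R)\<close>, whose signs cancel.\<close>

lemma summable_pochhammer_half:
  fixes R :: real
  shows "summable (\<lambda>k. pochhammer R (k + K) / fact (k + K) * (1 / 2) ^ k)"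
proof -
  have "(\<lambda>k. (- R gchoose k) * (- (1/2)) ^ k) sums (1 + - (1/2)) powr (- R)"
    by (rule gen_binomial_real) simp
  then have "summable (\<lambda>k. (- R gchoose k) * (- (1/2)) ^ k)" by (rule sums_summable)
  moreover have "(- R gchoose k) * (- (1/2)) ^ k = pochhammer R k / fact k * (1 / 2) ^ k" for k
    by (simp add: gbinomial_pochhammer power_mult_distrib[symmetric] mult.assoc mult.left_commute)
  ultimately have "summable (\<lambda>k. pochhammer R k / fact k * (1 / 2) ^ k)" by simp
  then have "summable (\<lambda>k. pochhammer R (k + K) / fact (k + K) * (1 / 2) ^ (k + K))"
    by (rule summable_ignore_initial_segment)
  then have "summable (\<lambda>k. 2 ^ K * (pochhammer R (k + K) / fact (k + K) * (1 / 2) ^ (k + K)))"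
    by (rule summable_mult)
  then show ?thesis by (simp add: power_add power_one_over field_simps)
qed

text \<open>Taking \<open>\<bar>x\<bar> ^ K\<close> out of the remainder leaves a series dominated
  by its value at \<open>\<bar>x\<bar> = 1/2\<close> with the coefficients at radius
  \<open>R\<close>; this value is \<open>C\<close>.\<close>

lemma binomial_remainder:
  assumes "R \<ge> 0"
  obtains C where "C \<ge> 0"
    "\<And>s x. norm (s::complex) \<le> R \<Longrightarrow> \<bar>x\<bar> \<le> 1 / 2 \<Longrightarrow>
       norm ((1 + of_real x) powr s - (\<Sum>k<K. (s gchoose k) * of_real x ^ k)) \<le> C * \<bar>x\<bar> ^ K"
proof
  define M where "M k = pochhammer R k / fact k" for k
  have M: "M k \<ge> 0" for k
    using assms by (auto simp: M_def pochhammer_prod intro!: divide_nonneg_nonneg prod_nonneg)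
  define C where "C = (\<Sum>k. M (k + K) * (1 / 2) ^ k)"
  have sumM: "summable (\<lambda>k. M (k + K) * (1 / 2) ^ k)"
    unfolding M_def by (rule summable_pochhammer_half)
  show "C \<ge> 0" unfolding C_def by (intro suminf_nonneg sumM) (simp add: M)
  fix s :: complex and x :: real
  assume s: "norm s \<le> R" and x: "\<bar>x\<bar> \<le> 1 / 2"
  let ?f = "\<lambda>k. (s gchoose k) * of_real x ^ k"
  have sums: "?f sums (1 + of_real x) powr s"
    using x by (intro gen_binomial_complex) simp
  have bound: "norm (?f (k + K)) \<le> \<bar>x\<bar> ^ K * (M (k + K) * (1 / 2) ^ k)" for k
  proof -
    have "norm (?f (k + K)) = norm (s gchoose (k + K)) * (\<bar>x\<bar> ^ k * \<bar>x\<bar> ^ K)"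
      by (simp add: norm_mult norm_power power_add)
    also have "\<dots> \<le> M (k + K) * ((1 / 2) ^ k * \<bar>x\<bar> ^ K)"
      using x norm_gbinomial_le[OF s] M unfolding M_def
      by (intro mult_mono power_mono mult_right_mono mult_nonneg_nonneg) auto
    finally show ?thesis by (simp add: mult_ac)
  qed
  have sumb: "summable (\<lambda>k. \<bar>x\<bar> ^ K * (M (k + K) * (1 / 2) ^ k))"
    by (intro summable_mult sumM)
  have "(1 + of_real x) powr s - (\<Sum>k<K. ?f k) = (\<Sum>k. ?f (k + K))"
    using suminf_minus_initial_segment[OF sums_summable[OF sums], of K] sums_unique[OF sums] by simp
  also have "norm \<dots> \<le> (\<Sum>k. \<bar>x\<bar> ^ K * (M (k + K) * (1 / 2) ^ k))"
    by (rule norm_suminf_le[OF bound sumb])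
  also have "\<dots> = C * \<bar>x\<bar> ^ K"
    unfolding C_def by (subst suminf_mult[OF sumM]) simp
  finally show "norm ((1 + of_real x) powr s - (\<Sum>k<K. ?f k)) \<le> C * \<bar>x\<bar> ^ K" .
qed

text \<open>For \<open>K = 0\<close> nothing is subtracted, and a term of the zeta series itself
  remains.\<close>

definition binomial_tail :: "real \<Rightarrow> real \<Rightarrow> (nat \<Rightarrow> real) \<Rightarrow> nat \<Rightarrow> complex \<Rightarrow> nat \<Rightarrow> complex" where
  "binomial_tail c r x K s n = of_real (c * r ^ n) powr (- s) *
     ((1 + of_real (x n)) powr (- s) - (\<Sum>k<K. ((- s) gchoose k) * of_real (x n) ^ k))"

text \<open>The leading power contributes \<open>r powr (- n * Re s)\<close> and the remainder
  \<open>r powr (- n * K)\<close>, up to constants. On a disc at distance at least \<open>d\<close>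
  from the line \<open>Re s = - K\<close> the product decays like
  \<open>r powr (- d * n)\<close>.\<close>

lemma binomial_tail_bound:
  fixes c r D :: real and x :: "nat \<Rightarrow> real"
  assumes "c > 0" "r > 1" and x: "\<And>n. n \<ge> 1 \<Longrightarrow> \<bar>x n\<bar> \<le> D * (1 / r) ^ n"
    and s0: "Re s0 > - real K"
  obtains d M where "d > 0" "cball s0 d \<subseteq> {s. Re s > - real K}" "summable M"
    "eventually (\<lambda>n. \<forall>s\<in>cball s0 d. norm (binomial_tail c r x K s n) \<le> M n) sequentially"
proof -
  \<comment> \<open>Half the distance from \<open>s0\<close> to the boundary line, so the closed
    disc stays equally far from it.\<close>
  define d where "d = (Re s0 + real K) / 2"
  have d: "d > 0" using s0 by (simp add: d_def)
  define R where "R = norm s0 + d"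
  have R: "R \<ge> 0" using d by (simp add: R_def)
  have ball: "Re s \<ge> - real K + d" "norm s \<le> R" if "s \<in> cball s0 d" for s
  proof -
    have "norm (s0 - s) \<le> d" using that by (simp add: dist_norm)
    then have "\<bar>Re s0 - Re s\<bar> \<le> d" using abs_Re_le_cmod[of "s0 - s"] by simp
    moreover have "2 * d = Re s0 + real K" by (simp add: d_def)
    ultimately show "Re s \<ge> - real K + d" by linarith
    show "norm s \<le> R" using \<open>norm (s0 - s) \<le> d\<close> norm_triangle_ineq2[of s s0]
      by (simp add: R_def norm_minus_commute)
  qed
  obtain C where C: "C \<ge> 0" "\<And>s x. norm (s::complex) \<le> R \<Longrightarrow> \<bar>x\<bar> \<le> 1 / 2 \<Longrightarrow>
       norm ((1 + of_real x) powr s - (\<Sum>k<K. (s gchoose k) * of_real x ^ k)) \<le> C * \<bar>x\<bar> ^ K"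
    using binomial_remainder[OF R] by metis
  \<comment> \<open>Bounds \<open>c powr (- Re s)\<close> on the disc for either sign of
    \<open>ln c\<close>.\<close>
  define E where "E = exp (R * \<bar>ln c\<bar>)"
  define M where "M n = E * C * D ^ K * (r powr (- d)) ^ n" for n
  have "\<bar>x 1\<bar> \<le> D * (1 / r)" using x[of 1] by simp
  then have "D * (1 / r) \<ge> 0" by (smt (verit) abs_ge_zero)
  then have D: "D \<ge> 0" using assms(2) by (simp add: zero_le_divide_iff)
  have "(\<lambda>n. D * (1 / r) ^ n) \<longlonglongrightarrow> D * 0"
    using assms(2) by (intro tendsto_mult tendsto_const LIMSEQ_power_zero) auto
  \<comment> \<open>The binomial estimate requires \<open>\<bar>x n\<bar> \<le> 1 / 2\<close>, which
    may fail for finitely many \<open>n\<close>.\<close>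
  then have "eventually (\<lambda>n. D * (1 / r) ^ n < 1 / 2) sequentially"
    by (rule order_tendstoD(2)) simp
  then have "eventually (\<lambda>n. \<forall>s\<in>cball s0 d. norm (binomial_tail c r x K s n) \<le> M n) sequentially"
    using eventually_ge_at_top[of 1]
  proof eventually_elim
    case (elim n)
    show ?case
    proof
      fix s assume s: "s \<in> cball s0 d"
      have "\<bar>x n\<bar> \<le> 1 / 2" using elim x[of n] by simp
      then have "norm ((1 + of_real (x n)) powr (- s) - (\<Sum>k<K. ((- s) gchoose k) * of_real (x n) ^ k)) \<le> C * \<bar>x n\<bar> ^ K"
        using ball(2)[OF s] by (intro C(2)) auto
      also have "\<dots> \<le> C * (D * (1 / r) ^ n) ^ K"
        using C(1) x[of n] elim by (intro mult_left_mono power_mono) auto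
      finally have 1: "norm ((1 + of_real (x n)) powr (- s) - (\<Sum>k<K. ((- s) gchoose k) * of_real (x n) ^ k))
          \<le> C * (D * (1 / r) ^ n) ^ K" .
      have "norm (of_real (c * r ^ n) powr (- s)) = (c * r ^ n) powr (- Re s)"
        using assms by (subst norm_powr_real_powr) auto
      also have "\<dots> = c powr (- Re s) * (r ^ n) powr (- Re s)"
        using assms by (intro powr_mult)
      also have "\<dots> \<le> E * (r powr (real K - d)) ^ n"
      proof (intro mult_mono)
        have "- Re s * ln c \<le> \<bar>Re s\<bar> * \<bar>ln c\<bar>" by (metis abs_ge_self abs_minus_cancel abs_mult)
        also have "\<dots> \<le> R * \<bar>ln c\<bar>"
          using abs_Re_le_cmod[of s] ball(2)[OF s] by (intro mult_right_mono) auto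
        finally show "c powr (- Re s) \<le> E" using assms(1) by (simp add: powr_def E_def)
        have "(r ^ n) powr (- Re s) = (r powr (- Re s)) ^ n"
          using assms(2) by (simp add: powr_realpow[symmetric] powr_powr mult.commute)
        also have "\<dots> \<le> (r powr (real K - d)) ^ n"
          using assms(2) ball(1)[OF s] by (intro power_mono powr_mono) auto
        finally show "(r ^ n) powr (- Re s) \<le> (r powr (real K - d)) ^ n" .
      qed (auto simp: E_def)
      finally have 2: "norm (of_real (c * r ^ n) powr (- s)) \<le> E * (r powr (real K - d)) ^ n" .
      have "norm (binomial_tail c r x K s n) \<le> (E * (r powr (real K - d)) ^ n) * (C * (D * (1 / r) ^ n) ^ K)"
        unfolding binomial_tail_def norm_mult
        by (intro mult_mono 1 2) (auto simp: E_def)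
      also have "\<dots> = E * C * D ^ K * (r powr (real K - d) * (1 / r) ^ K) ^ n"
        by (simp add: power_mult_distrib power_mult[symmetric] mult.commute mult.left_commute)
      also have "r powr (real K - d) * (1 / r) ^ K = r powr (- d)"
        using assms(2) by (simp add: powr_diff powr_realpow power_one_over powr_minus field_simps)
      finally show "norm (binomial_tail c r x K s n) \<le> M n" by (simp add: M_def)
    qed
  qed
  moreover have "summable M"
    unfolding M_def using assms(2) d by (intro summable_mult summable_geometric) (auto simp: powr_less_one)
  moreover have "cball s0 d \<subseteq> {s. Re s > - real K}" using ball(1) d by fastforce
  ultimately show ?thesis using that d by blast
qed

lemma holomorphic_on_gbinomial [holomorphic_intros]:
  assumes "f holomorphic_on A"
  shows "(\<lambda>z. f z gchoose k) holomorphic_on A"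
  unfolding gbinomial_prod_rev using assms by (intro holomorphic_intros) auto

lemma summable_binomial_tail:
  fixes c r D :: real and x :: "nat \<Rightarrow> real"
  assumes "c > 0" "r > 1" and x: "\<And>n. n \<ge> 1 \<Longrightarrow> \<bar>x n\<bar> \<le> D * (1 / r) ^ n"
    and s: "Re s > - real K"
  shows "summable (\<lambda>n. binomial_tail c r x K s (Suc n))"
proof -
  obtain d M where d: "d > 0" "summable M"
    and M: "eventually (\<lambda>n. \<forall>s\<in>cball s d. norm (binomial_tail c r x K s n) \<le> M n) sequentially"
    by (rule binomial_tail_bound[OF assms(1,2) x s])
  have "eventually (\<lambda>n. norm (binomial_tail c r x K s n) \<le> M n) sequentially"
    using M by (rule eventually_mono) (use d in auto)
  then have "summable (binomial_tail c r x K s)"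
    using d(2) by (rule summable_comparison_test_ev)
  then show ?thesis by (subst summable_Suc_iff)
qed

lemma holomorphic_binomial_tail:
  fixes c r D :: real and x :: "nat \<Rightarrow> real"
  assumes "c > 0" "r > 1" and x: "\<And>n. n \<ge> 1 \<Longrightarrow> \<bar>x n\<bar> \<le> D * (1 / r) ^ n"
    and "\<And>n. n \<ge> 1 \<Longrightarrow> x n > -1"
  shows "(\<lambda>s. \<Sum>n. binomial_tail c r x K s (Suc n)) holomorphic_on {s. Re s > - real K}"
proof (rule holomorphic_uniform_sequence[where f = "\<lambda>N s. \<Sum>n<N. binomial_tail c r x K s (Suc n)"])
  show "open {s. Re s > - real K}" by (rule open_halfspace_Re_gt)
  \<comment> \<open>A nonzero base makes each power an entire function of its exponent.\<close>
  have ne: "1 + complex_of_real (x (Suc n)) \<noteq> 0" for n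
  proof -
    have "1 + x (Suc n) \<noteq> 0" using assms(4)[of "Suc n"] by simp
    then show ?thesis by (metis of_real_1 of_real_add of_real_eq_0_iff)
  qed
  show "(\<lambda>s. \<Sum>n<N. binomial_tail c r x K s (Suc n)) holomorphic_on {s. Re s > - real K}" for N
    unfolding binomial_tail_def using assms(1,2) ne
    by (intro holomorphic_intros)
  fix s0 assume "s0 \<in> {s. Re s > - real K}"
  then have s0: "Re s0 > - real K" by simp
  obtain d M where "d > 0" "cball s0 d \<subseteq> {s. Re s > - real K}" "summable M" and
    M: "eventually (\<lambda>n. \<forall>s\<in>cball s0 d. norm (binomial_tail c r x K s n) \<le> M n) sequentially"
    by (rule binomial_tail_bound[OF assms(1,2) x s0])
  moreover from M have "eventually (\<lambda>n. \<forall>s\<in>cball s0 d. norm (binomial_tail c r x K s (Suc n)) \<le> M (Suc n)) sequentially"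
    by (subst eventually_sequentially_Suc)
  with \<open>summable M\<close> have "uniform_limit (cball s0 d) (\<lambda>N s. \<Sum>n<N. binomial_tail c r x K s (Suc n))
      (\<lambda>s. \<Sum>n. binomial_tail c r x K s (Suc n)) sequentially"
    by (intro Weierstrass_m_test_ev[where M = "\<lambda>n. M (Suc n)"]) (auto simp: summable_Suc_iff)
  ultimately show "\<exists>d>0. cball s0 d \<subseteq> {s. Re s > - real K} \<and>
      uniform_limit (cball s0 d) (\<lambda>N s. \<Sum>n<N. binomial_tail c r x K s (Suc n))
        (\<lambda>s. \<Sum>n. binomial_tail c r x K s (Suc n)) sequentially"
    by blast
qed

section \<open>Local behaviour at simple poles\<close>

lemma simple_pole_local:
  fixes f A h :: "complex \<Rightarrow> complex"
  assumes "A analytic_on {p}" "h analytic_on {p}"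
    and ev: "eventually (\<lambda>s. f s = A s + h s / (s - p)) (at p)"
  shows "residue f p = h p" "is_pole f p \<Longrightarrow> zorder f p = -1" "f meromorphic_on {p}"
proof -
  define g where "g s = A s * (s - p) + h s" for s
  have "g analytic_on {p}" unfolding g_def using assms(1,2) by (intro analytic_intros)
  then obtain e where e: "e > 0" "g holomorphic_on ball p e" unfolding analytic_at_ball by auto
  have "eventually (\<lambda>s::complex. s \<noteq> p) (at p)" by (rule eventually_neq_at_within)
  with ev have ev': "eventually (\<lambda>s. f s = g s / (s - p)) (at p)"
    by eventually_elim (simp add: g_def field_simps)
  have "residue f p = residue (\<lambda>s. g s / (s - p)) p"
    by (rule residue_cong[OF ev' refl])
  also have "\<dots> = g p" using e by (intro residue_simple[of "ball p e"]) auto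
  finally show "residue f p = h p" by (simp add: g_def)
  have "(\<lambda>s. g s / (s - p)) meromorphic_on {p}"
    using \<open>g analytic_on {p}\<close> by (intro meromorphic_intros analytic_on_imp_meromorphic_on)
  then show "f meromorphic_on {p}" using meromorphic_on_cong[of "{p}" f "\<lambda>s. g s / (s - p)"] ev' by auto
  \<comment> \<open>The value \<open>h p\<close> may be zero, and then the singularity is removable.
    A pole forces \<open>g p \<noteq> 0\<close>, since otherwise the quotient has the finite limit
    \<open>deriv g p\<close>.\<close>
  assume pole: "is_pole f p"
  have "g p \<noteq> 0"
  proof
    assume "g p = 0"
    then have "((\<lambda>s. (g s - g p) / (s - p)) \<longlongrightarrow> deriv g p) (at p)"
      using holomorphic_derivI[OF e(2), of p] e(1) by (simp add: has_field_derivative_iff)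
    then have "(f \<longlongrightarrow> deriv g p) (at p)"
      using ev' \<open>g p = 0\<close> by (simp add: tendsto_cong[OF ev'])
    with pole show False unfolding is_pole_def
      using not_tendsto_and_filterlim_at_infinity[of "at p"] by auto
  qed
  obtain d where d: "d > 0" "\<And>s. s \<in> ball p d \<Longrightarrow> s \<noteq> p \<Longrightarrow> f s = g s / (s - p)"
    using ev' unfolding eventually_at by (auto simp: dist_commute)
  show "zorder f p = -1"
  proof (rule zorder_eqI[of "ball p (min d e)"])
    show "g holomorphic_on ball p (min d e)" using e(2) by (rule holomorphic_on_subset) auto
    show "f w = g w * (w - p) powi -1" if "w \<in> ball p (min d e)" "w \<noteq> p" for w
      using d(2)[of w] that by (simp add: power_int_minus divide_inverse)
  qed (use d e \<open>g p \<noteq> 0\<close> in auto)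
qed

text \<open>The denominator has a simple zero at \<open>p\<close> with derivative \<open>L\<close>.
  With \<open>L = Ln (\<alpha> 1)\<close> this is the origin of the factor
  \<open>1 / log \<alpha>\<close> in the residue.\<close>

lemma geometric_pole:
  fixes L p :: complex
  assumes "L \<noteq> 0"
  obtains h where "h analytic_on {p}" "h p = 1 / L"
    "eventually (\<lambda>s. exp (- (L * (s - p))) / (1 - exp (- (L * (s - p)))) = h s / (s - p)) (at p)"
proof -
  define g where "g s = 1 - exp (- (L * (s - p)))" for s
  have g: "g holomorphic_on UNIV" unfolding g_def by (intro holomorphic_intros)
  have dg: "(g has_field_derivative L) (at p)"
    unfolding g_def by (auto intro!: derivative_eq_intros)
  define q where "q s = (if s = p then deriv g p else g s / (s - p))" for s
  have q: "q analytic_on UNIV"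
    by (rule pole_theorem_analytic_0[of g _ p])
       (use g in \<open>auto simp: q_def g_def analytic_on_open intro!: exI[of _ 1]\<close>)
  have qp: "q p = L" using dg by (simp add: q_def DERIV_imp_deriv)
  define h where "h s = exp (- (L * (s - p))) / q s" for s
  have "h analytic_on {p}"
    unfolding h_def using qp assms q by (intro analytic_intros) (auto intro: analytic_on_subset)
  moreover have "h p = 1 / L" by (simp add: h_def qp)
  moreover have "eventually (\<lambda>s. exp (- (L * (s - p))) / (1 - exp (- (L * (s - p)))) = h s / (s - p)) (at p)"
    using eventually_neq_at_within[of p p UNIV]
    by eventually_elim (simp add: h_def q_def g_def)
  ultimately show ?thesis using that by blast
qed

section \<open>Meromorphic continuation\<close>

context gfib_root_list
begin

text \<open>The residue formula without its factor \<open>1 / log \<alpha>\<close> and with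
  \<open>s\<close> left free: an entire function that multiplies the geometric series.\<close>

definition pole_coeff :: "(nat \<Rightarrow> nat) \<Rightarrow> complex \<Rightarrow> complex" where
  "pole_coeff \<kappa> s =
     (let k = sum \<kappa> {2..l}; A = gfib_coeff l (\<alpha> 1) in
        A powr (- s) * ((- s) gchoose k) * A powi (- int k)
        * (fact k / (\<Prod>i\<in>{2..l}. fact (\<kappa> i)))
        * (\<Prod>i\<in>{2..l}. gfib_coeff l (\<alpha> i) ^ \<kappa> i))"

lemma gfib_residue_eq:
  "gfib_residue l \<alpha> (sum \<kappa> {2..l}) \<kappa> n = pole_coeff \<kappa> (gfib_pole l \<alpha> (sum \<kappa> {2..l}) \<kappa> n) * (1 / Ln (\<alpha> 1))"
  by (simp add: gfib_residue_def pole_coeff_def Let_def)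

text \<open>The common ratio of the geometric series in \<open>n\<close> for the vector
  \<open>\<kappa>\<close>, written with the same logarithms as \<open>gfib_pole\<close>.\<close>

definition ratio :: "(nat \<Rightarrow> nat) \<Rightarrow> complex \<Rightarrow> complex" where
  "ratio \<kappa> s = exp ((\<Sum>i\<in>{2..l}. of_nat (\<kappa> i) * Ln (\<alpha> i)) - (s + of_nat (sum \<kappa> {2..l})) * Ln (\<alpha> 1))"

lemma Ln_nonzero: "Ln (\<alpha> 1) \<noteq> 0"
  unfolding Ln_dominant_root(1) using Ln_dominant_root(2) by simp

lemma ratio_gfib_pole: "ratio \<kappa> (gfib_pole l \<alpha> (sum \<kappa> {2..l}) \<kappa> n) = 1"
proof -
  define S where "S = (\<Sum>i\<in>{2..l}. of_nat (\<kappa> i) * Ln (\<alpha> i))"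
  have "(gfib_pole l \<alpha> (sum \<kappa> {2..l}) \<kappa> n + of_nat (sum \<kappa> {2..l})) * Ln (\<alpha> 1)
      = 2 * of_int n * \<i> * of_real pi + S"
    unfolding gfib_pole_def S_def[symmetric] using Ln_nonzero by simp
  then have "ratio \<kappa> (gfib_pole l \<alpha> (sum \<kappa> {2..l}) \<kappa> n) = exp (- (2 * of_int n * \<i> * of_real pi))"
    unfolding ratio_def S_def[symmetric] by simp
  also have "\<dots> = 1"
    unfolding exp_eq_1 by (intro conjI exI[of _ "- n"]) auto
  finally show ?thesis .
qed

lemma ratio_eq_1_imp_pole:
  assumes "ratio \<kappa> s = 1"
  shows "s \<in> gfib_poles l \<alpha>"
proof -
  define S where "S = (\<Sum>i\<in>{2..l}. of_nat (\<kappa> i) * Ln (\<alpha> i))"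
  define k where "k = sum \<kappa> {2..l}"
  define z where "z = S - (s + of_nat k) * Ln (\<alpha> 1)"
  have "exp z = 1" using assms unfolding ratio_def S_def z_def k_def .
  then obtain n :: int where "Re z = 0" "Im z = of_int (2 * n) * pi" unfolding exp_eq_1 by auto
  then have z: "z = 2 * of_int n * \<i> * of_real pi" by (simp add: complex_eq_iff)
  \<comment> \<open>\<open>s\<close> enters \<open>z\<close> with a negative sign, hence the integer
    \<open>- n\<close>.\<close>
  have "s = gfib_pole l \<alpha> k \<kappa> (- n)"
    unfolding gfib_pole_def S_def[symmetric] using z Ln_nonzero
    by (simp add: z_def field_simps)
  then show ?thesis unfolding gfib_poles_def k_def by blast
qed

lemma ratio_shift:
  assumes "ratio \<kappa> p = 1"
  shows "ratio \<kappa> s = exp (- (Ln (\<alpha> 1) * (s - p)))"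
proof -
  have "ratio \<kappa> s = ratio \<kappa> p * exp (- (Ln (\<alpha> 1) * (s - p)))"
    unfolding ratio_def exp_add[symmetric] by (simp add: algebra_simps)
  with assms show ?thesis by simp
qed

text \<open>The logarithms of the minor roots occur only through their exponentials, so an equality
  of poles becomes algebraic.\<close>

lemma ratio_eq: "ratio \<kappa> s = (\<Prod>i\<in>{2..l}. \<alpha> i ^ \<kappa> i) * exp (- s * Ln (\<alpha> 1)) / \<alpha> 1 ^ sum \<kappa> {2..l}"
proof -
  have "exp (\<Sum>i\<in>{2..l}. of_nat (\<kappa> i) * Ln (\<alpha> i)) = (\<Prod>i\<in>{2..l}. \<alpha> i ^ \<kappa> i)"
    unfolding exp_sum[OF finite_atLeastAtMost] exp_of_nat_mult
    by (intro prod.cong refl arg_cong[of _ _ "\<lambda>x. x ^ _"] exp_Ln root_equation(2)) auto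
  moreover have "exp (of_nat (sum \<kappa> {2..l}) * Ln (\<alpha> 1)) = \<alpha> 1 ^ sum \<kappa> {2..l}"
    unfolding exp_of_nat_mult using root_equation(2)[OF one_index] by simp
  ultimately show ?thesis
    unfolding ratio_def by (simp add: exp_diff exp_add exp_minus distrib_right field_simps)
qed

lemma norm_ratio_less_1:
  assumes "Re s > - real (sum \<kappa> {2..l})"
  shows "norm (ratio \<kappa> s) < 1"
proof -
  have "(\<Sum>i\<in>{2..l}. real (\<kappa> i) * ln (cmod (\<alpha> i))) \<le> 0"
  proof (intro sum_nonpos mult_nonneg_nonpos)
    fix i assume "i \<in> {2..l}"
    then have "cmod (\<alpha> i) < 1" "cmod (\<alpha> i) > 0" using other_roots root_equation(2) by auto
    then show "ln (cmod (\<alpha> i)) \<le> 0" by simp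
  qed auto
  moreover have "Re (\<Sum>i\<in>{2..l}. of_nat (\<kappa> i) * Ln (\<alpha> i)) = (\<Sum>i\<in>{2..l}. real (\<kappa> i) * ln (cmod (\<alpha> i)))"
    unfolding Re_sum using root_equation(2) by (intro sum.cong) auto
  moreover have "(Re s + real (sum \<kappa> {2..l})) * ln r > 0"
    using assms Ln_dominant_root(2) by (intro mult_pos_pos) auto
  ultimately have "Re ((\<Sum>i\<in>{2..l}. of_nat (\<kappa> i) * Ln (\<alpha> i)) - (s + of_nat (sum \<kappa> {2..l})) * Ln (\<alpha> 1)) < 0"
    unfolding Ln_dominant_root(1) by simp
  then show ?thesis unfolding ratio_def norm_exp_eq_Re by simp
qed

text \<open>Both equations contain the same factor \<open>exp (- p * Ln (\<alpha> 1))\<close>.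
  Eliminating it leaves a multiplicative relation between the roots, in which
  \<open>\<alpha> 1\<close> carries the exponents \<open>k'\<close> and \<open>k\<close>
  crosswise.\<close>

lemma ratio_eq_1_unique:
  assumes "\<kappa> \<in> multi_indices {2..l} k" "\<kappa>' \<in> multi_indices {2..l} k'"
    and "ratio \<kappa> p = 1" "ratio \<kappa>' p = 1"
  shows "\<kappa> = \<kappa>'"
proof -
  define E where "E = exp (- p * Ln (\<alpha> 1))"
  have a1: "\<alpha> 1 \<noteq> 0" by (rule root_equation(2)[OF one_index])
  have k: "sum \<kappa> {2..l} = k" "sum \<kappa>' {2..l} = k'"
    using assms(1,2) by (auto simp: multi_indices_def)
  have eq: "(\<Prod>i\<in>{2..l}. \<alpha> i ^ \<kappa> i) * E = \<alpha> 1 ^ k" "(\<Prod>i\<in>{2..l}. \<alpha> i ^ \<kappa>' i) * E = \<alpha> 1 ^ k'"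
    using assms(3,4) a1 unfolding ratio_eq E_def[symmetric] k by (auto simp: field_simps)
  have "\<alpha> 1 ^ k' * (\<Prod>i\<in>{2..l}. \<alpha> i ^ \<kappa> i) = (\<Prod>i\<in>{2..l}. \<alpha> i ^ \<kappa>' i) * E * (\<Prod>i\<in>{2..l}. \<alpha> i ^ \<kappa> i)"
    by (simp only: eq(2))
  also have "\<dots> = \<alpha> 1 ^ k * (\<Prod>i\<in>{2..l}. \<alpha> i ^ \<kappa>' i)"
    by (simp only: eq(1)[symmetric] mult_ac)
  finally have rel: "\<alpha> 1 ^ k' * (\<Prod>i\<in>{2..l}. \<alpha> i ^ \<kappa> i) = \<alpha> 1 ^ k * (\<Prod>i\<in>{2..l}. \<alpha> i ^ \<kappa>' i)" .
  have ins: "{1..l} = insert 1 {2..l}" using l_ge_2 by auto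
  have split: "(\<Prod>i\<in>{1..l}. \<alpha> i ^ (f(1 := e)) i) = \<alpha> 1 ^ e * (\<Prod>i\<in>{2..l}. \<alpha> i ^ f i)" for f e
    unfolding ins by (subst prod.insert) (auto intro!: prod.cong)
  have "\<exists>c::int. \<forall>i\<in>{1..l}. int ((\<kappa>(1 := k')) i) - int ((\<kappa>'(1 := k)) i) = c"
    by (rule multiplicative_relation_constant) (unfold split, rule rel)
  then obtain c :: int where c: "\<And>i. i \<in> {1..l} \<Longrightarrow> int ((\<kappa>(1 := k')) i) - int ((\<kappa>'(1 := k)) i) = c" by blast
  have c1: "int k' - int k = c" using c[OF one_index] by simp
  have c2: "int (\<kappa> i) - int (\<kappa>' i) = c" if "i \<in> {2..l}" for i using c[of i] that by auto
  \<comment> \<open>Homogeneity: index 1 gives \<open>c = k' - k\<close>, while the other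
    \<open>l - 1\<close> indices add up to \<open>(l - 1) * c = k - k'\<close>. Together
    \<open>l * c = 0\<close>.\<close>
  have "int k - int k' = (\<Sum>i\<in>{2..l}. int (\<kappa> i) - int (\<kappa>' i))"
    unfolding k[symmetric] by (simp add: sum_subtractf)
  also have "\<dots> = (int l - 1) * c" using c2 l_ge_2 by (simp add: of_nat_diff)
  finally have "int l * c = 0" using c1 by (simp add: algebra_simps)
  then have "c = 0" using l_ge_2 by simp
  show ?thesis
  proof
    fix i
    show "\<kappa> i = \<kappa>' i"
      using c2[of i] \<open>c = 0\<close> assms(1,2) by (cases "i \<in> {2..l}") (auto simp: multi_indices_def)
  qed
qed

text \<open>After the multinomial expansion, \<open>n\<close> occurs in each summand only as an
  exponent, so summing over \<open>n\<close> gives geometric series.\<close>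

lemma binomial_tail_term:
  assumes n: "n \<ge> 1"
  shows "of_real (c * r ^ n) powr (- s) * (((- s) gchoose k) * of_real (rel_err n) ^ k)
      = (\<Sum>\<kappa>\<in>multi_indices {2..l} k. pole_coeff \<kappa> s * ratio \<kappa> s ^ n)"
proof -
  define A E where "A = complex_of_real c" and "E = exp (- s * Ln (\<alpha> 1))"
  have nz: "A \<noteq> 0" "\<alpha> 1 \<noteq> 0"
    using dominant_coeff(2) root_equation(2)[OF one_index] by (auto simp: A_def)
  have "of_real (r ^ n) powr (- s) = E ^ n"
  proof -
    have "Ln (of_real (r ^ n)) = of_nat n * Ln (\<alpha> 1)"
      unfolding Ln_dominant_root(1) using dominant_root(2)
      by (subst Ln_of_real) (auto simp: ln_realpow)
    then show ?thesis using dominant_root(2)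
      unfolding E_def exp_of_nat_mult[symmetric] powr_def by (simp add: mult_ac)
  qed
  \<comment> \<open>Splitting the complex power is legitimate because both factors are positive
    reals.\<close>
  moreover have "of_real (c * r ^ n) powr (- s) = of_real c powr (- s) * of_real (r ^ n) powr (- s)"
    unfolding of_real_mult using dominant_coeff(2) dominant_root(2) by (intro powr_times_real) auto
  ultimately have 1: "of_real (c * r ^ n) powr (- s) = A powr (- s) * E ^ n" by (simp add: A_def)
  have "minor n ^ k = fact k * (\<Sum>\<kappa>\<in>multi_indices {2..l} k.
      \<Prod>i\<in>{2..l}. (gfib_coeff l (\<alpha> i) * \<alpha> i ^ n) ^ \<kappa> i / fact (\<kappa> i))"
    unfolding minor_def multinomial_theorem[OF finite_atLeastAtMost, symmetric] by simp
  then have 2: "of_real (rel_err n) ^ k = (\<Sum>\<kappa>\<in>multi_indices {2..l} k.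
      (\<Prod>i\<in>{2..l}. (gfib_coeff l (\<alpha> i) * \<alpha> i ^ n) ^ \<kappa> i / fact (\<kappa> i)) * fact k / (A * \<alpha> 1 ^ n) ^ k)"
    unfolding rel_err(1)[OF n] power_divide A_def[symmetric]
    by (simp add: sum_distrib_left sum_divide_distrib mult.commute)
  show ?thesis
    unfolding 1 2 sum_distrib_left
  proof (intro sum.cong refl)
    fix \<kappa> assume "\<kappa> \<in> multi_indices {2..l} k"
    then have k: "sum \<kappa> {2..l} = k" by (simp add: multi_indices_def)
    define P where "P = (\<Prod>i\<in>{2..l}. \<alpha> i ^ \<kappa> i)"
    define Q where "Q = (\<Prod>i\<in>{2..l}. gfib_coeff l (\<alpha> i) ^ \<kappa> i)"
    define F where "F = (\<Prod>i\<in>{2..l}. fact (\<kappa> i) :: complex)"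
    have prod: "(\<Prod>i\<in>{2..l}. (gfib_coeff l (\<alpha> i) * \<alpha> i ^ n) ^ \<kappa> i / fact (\<kappa> i)) = Q * P ^ n / F"
      unfolding P_def Q_def F_def prod_power_distrib prod.distrib[symmetric] prod_dividef[symmetric]
      by (intro prod.cong refl) (simp add: power_mult_distrib power_mult[symmetric] mult.commute)
    have pc: "pole_coeff \<kappa> s = A powr (- s) * ((- s) gchoose k) * inverse (A ^ k) * (fact k / F) * Q"
      unfolding pole_coeff_def Let_def k dominant_coeff(1) A_def[symmetric] F_def Q_def power_int_minus
      by simp
    have rt: "ratio \<kappa> s = P * E / \<alpha> 1 ^ k"
      unfolding ratio_eq k P_def E_def ..
    have "(\<alpha> 1 ^ n) ^ k = (\<alpha> 1 ^ k) ^ n" by (metis power_mult mult.commute)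
    then show "A powr (- s) * E ^ n * (((- s) gchoose k) *
        ((\<Prod>i\<in>{2..l}. (gfib_coeff l (\<alpha> i) * \<alpha> i ^ n) ^ \<kappa> i / fact (\<kappa> i)) * fact k / (A * \<alpha> 1 ^ n) ^ k))
        = pole_coeff \<kappa> s * ratio \<kappa> s ^ n"
      unfolding prod pc rt by (simp add: power_mult_distrib power_inverse divide_inverse mult_ac)
  qed
qed

section \<open>Gluing the expressions on half-planes\<close>

definition zeta_part :: "nat \<Rightarrow> complex \<Rightarrow> complex" where
  "zeta_part K s = (\<Sum>k<K. \<Sum>\<kappa>\<in>multi_indices {2..l} k. pole_coeff \<kappa> s * (ratio \<kappa> s / (1 - ratio \<kappa> s)))
     + (\<Sum>n. binomial_tail c r rel_err K s (Suc n))"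

lemma summable_tail:
  assumes "Re s > - real K"
  shows "summable (\<lambda>n. binomial_tail c r rel_err K s (Suc n))"
  using dominant_coeff(2) dominant_root(2) rel_err(4) assms by (rule summable_binomial_tail)

lemma holomorphic_tail:
  "(\<lambda>s. \<Sum>n. binomial_tail c r rel_err K s (Suc n)) holomorphic_on {s. Re s > - real K}"
  using dominant_coeff(2) dominant_root(2) rel_err(4) rel_err(2) by (rule holomorphic_binomial_tail)

lemma zeta_part_Suc:
  assumes s: "Re s > - real K"
  shows "zeta_part (Suc K) s = zeta_part K s"
proof -
  let ?I = "multi_indices {2..l} K"
  have geo: "(\<lambda>n. pole_coeff \<kappa> s * ratio \<kappa> s ^ Suc n) sums (pole_coeff \<kappa> s * (ratio \<kappa> s / (1 - ratio \<kappa> s)))"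
    if "\<kappa> \<in> ?I" for \<kappa>
  proof -
    have "norm (ratio \<kappa> s) < 1"
      using that s by (intro norm_ratio_less_1) (simp add: multi_indices_def)
    from sums_mult[OF geometric_sums[OF this], of "pole_coeff \<kappa> s * ratio \<kappa> s"]
    show ?thesis by (simp add: mult_ac)
  qed
  have "binomial_tail c r rel_err (Suc K) s (Suc n)
      = binomial_tail c r rel_err K s (Suc n) - (\<Sum>\<kappa>\<in>?I. pole_coeff \<kappa> s * ratio \<kappa> s ^ Suc n)" for n
  proof -
    have "binomial_tail c r rel_err (Suc K) s (Suc n) = binomial_tail c r rel_err K s (Suc n)
        - of_real (c * r ^ Suc n) powr (- s) * (((- s) gchoose K) * of_real (rel_err (Suc n)) ^ K)"
      by (simp only: binomial_tail_def sum.lessThan_Suc right_diff_distrib distrib_left diff_diff_eq)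
    then show ?thesis by (subst (asm) binomial_tail_term) auto
  qed
  moreover have S: "(\<lambda>n. binomial_tail c r rel_err K s (Suc n) - (\<Sum>\<kappa>\<in>?I. pole_coeff \<kappa> s * ratio \<kappa> s ^ Suc n)) sums
      ((\<Sum>n. binomial_tail c r rel_err K s (Suc n)) - (\<Sum>\<kappa>\<in>?I. pole_coeff \<kappa> s * (ratio \<kappa> s / (1 - ratio \<kappa> s))))"
    by (intro sums_diff sums_sum geo summable_sums summable_tail s)
  ultimately have "(\<Sum>n. binomial_tail c r rel_err (Suc K) s (Suc n))
      = (\<Sum>n. binomial_tail c r rel_err K s (Suc n)) - (\<Sum>\<kappa>\<in>?I. pole_coeff \<kappa> s * (ratio \<kappa> s / (1 - ratio \<kappa> s)))"
    by (simp only: sums_unique[OF S, symmetric])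
  then show ?thesis unfolding zeta_part_def by simp
qed

lemma zeta_part_mono:
  assumes "K \<le> K'" "Re s > - real K"
  shows "zeta_part K' s = zeta_part K s"
  using assms(1)
proof (induction K' rule: dec_induct)
  case (step m)
  then show ?case using zeta_part_Suc[of m s] assms(2) by simp
qed simp

lemma gfib_zeta_term_eq: "gfib_zeta_term l s (Suc n) = binomial_tail c r rel_err 0 s (Suc n)"
proof -
  have "of_nat (gfib l (int (Suc n))) = complex_of_real (c * r ^ Suc n) * (1 + of_real (rel_err (Suc n)))"
    using arg_cong[OF rel_err(3)[of "Suc n"], of complex_of_real] by simp
  moreover have "(complex_of_real (c * r ^ Suc n) * (1 + of_real (rel_err (Suc n)))) powr (- s)
      = of_real (c * r ^ Suc n) powr (- s) * (1 + of_real (rel_err (Suc n))) powr (- s)"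
    using dominant_coeff(2) dominant_root(2) rel_err(2)[of "Suc n"] by (intro powr_times_real) auto
  ultimately show ?thesis by (simp only: gfib_zeta_term_def binomial_tail_def) simp
qed

text \<open>The order \<open>K\<close> chosen here satisfies \<open>1 - Re s \<le> K\<close>, so
  \<open>s\<close> lies strictly inside the half-plane \<open>Re s > - K\<close>; for
  \<open>Re s \<ge> 1\<close> it is 0.\<close>

definition zeta_ext :: "complex \<Rightarrow> complex" where
  "zeta_ext s = zeta_part (nat \<lceil>1 - Re s\<rceil>) s"

lemma zeta_ext_eq:
  assumes "Re s > - real K"
  shows "zeta_ext s = zeta_part K s"
proof -
  define M where "M = nat \<lceil>1 - Re s\<rceil>"
  have "1 - Re s \<le> real M" unfolding M_def by linarith
  then have "Re s > - real M" by simp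
  with assms have "zeta_part M s = zeta_part K s"
    using zeta_part_mono[of K M s] zeta_part_mono[of M K s] linear[of K M] by argo
  then show ?thesis unfolding zeta_ext_def M_def[symmetric] .
qed

text \<open>The order used by \<open>zeta_ext\<close> jumps with \<open>Re s\<close>; local
  properties are obtained by fixing one order on a neighbourhood.\<close>

lemma eventually_zeta_ext_eq:
  assumes "Re p > - real K"
  shows "eventually (\<lambda>s. zeta_ext s = zeta_part K s) (nhds p)"
proof -
  have "eventually (\<lambda>s. s \<in> {s. Re s > - real K}) (nhds p)"
    using assms by (intro eventually_nhds_in_open open_halfspace_Re_gt) simp
  then show ?thesis by (rule eventually_mono) (simp add: zeta_ext_eq)
qed

lemma analytic_pole_coeff: "pole_coeff \<kappa> analytic_on S"
proof -
  have "pole_coeff \<kappa> holomorphic_on UNIV"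
    unfolding pole_coeff_def Let_def using dominant_coeff
    by (intro holomorphic_intros)
  then have "pole_coeff \<kappa> analytic_on UNIV" by (simp add: analytic_on_open)
  then show ?thesis by (rule analytic_on_subset) simp
qed

lemma analytic_pole_term:
  assumes "ratio \<kappa> p \<noteq> 1"
  shows "(\<lambda>s. pole_coeff \<kappa> s * (ratio \<kappa> s / (1 - ratio \<kappa> s))) analytic_on {p}"
proof -
  have "ratio \<kappa> holomorphic_on UNIV" unfolding ratio_def by (intro holomorphic_intros)
  then have "ratio \<kappa> analytic_on UNIV" by (simp add: analytic_on_open)
  then have "ratio \<kappa> analytic_on {p}" by (rule analytic_on_subset) simp
  with assms show ?thesis
    by (intro analytic_on_mult analytic_on_divide analytic_on_diff analytic_on_const analytic_pole_coeff) auto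
qed

lemma analytic_tail:
  assumes "Re p > - real K"
  shows "(\<lambda>s. \<Sum>n. binomial_tail c r rel_err K s (Suc n)) analytic_on {p}"
proof (rule analytic_on_subset)
  show "(\<lambda>s. \<Sum>n. binomial_tail c r rel_err K s (Suc n)) analytic_on {s. Re s > - real K}"
    using holomorphic_tail[of K] by (simp add: analytic_on_open open_halfspace_Re_gt)
qed (use assms in simp)

lemma half_plane_exists:
  obtains K where "Re p > - real K" "K > k"
proof -
  obtain K where "real K > max (- Re p) (real k)" using reals_Archimedean2 by blast
  then show ?thesis using that[of K] by simp
qed

lemma zeta_ext_analytic:
  assumes "p \<notin> gfib_poles l \<alpha>"
  shows "zeta_ext analytic_on {p}"
proof -
  obtain K where K: "Re p > - real K" using half_plane_exists by metis
  have "zeta_part K analytic_on {p}"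
    unfolding zeta_part_def using assms ratio_eq_1_imp_pole
    by (intro analytic_intros analytic_tail analytic_pole_term K) auto
  then show ?thesis using analytic_at_cong[OF eventually_zeta_ext_eq[OF K] refl] by simp
qed

text \<open>By \<open>ratio_eq_1_unique\<close> exactly one summand of \<open>zeta_part K\<close>
  has a vanishing denominator at \<open>p\<close>; the rest is analytic there and leaves the residue
  unchanged.\<close>

lemma zeta_ext_pole:
  fixes \<kappa> :: "nat \<Rightarrow> nat" and n :: int
  defines "k \<equiv> sum \<kappa> {2..l}"
  defines "p \<equiv> gfib_pole l \<alpha> k \<kappa> n"
  shows "residue zeta_ext p = gfib_residue l \<alpha> k \<kappa> n"
    and "is_pole zeta_ext p \<Longrightarrow> zorder zeta_ext p = -1"
    and "zeta_ext meromorphic_on {p}"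
proof -
  \<comment> \<open>\<open>\<kappa>\<close> is arbitrary outside \<open>{2..l}\<close>; cutting it
    off there gives the representative that occurs in the sum.\<close>
  define \<kappa>\<^sub>0 where "\<kappa>\<^sub>0 = (\<lambda>i. if i \<in> {2..l} then \<kappa> i else 0)"
  have \<kappa>\<^sub>0: "\<kappa>\<^sub>0 \<in> multi_indices {2..l} k"
    by (auto simp: multi_indices_def \<kappa>\<^sub>0_def k_def)
  have sum0: "sum \<kappa>\<^sub>0 {2..l} = k" by (simp add: \<kappa>\<^sub>0_def k_def)
  have same: "pole_coeff \<kappa>\<^sub>0 s = pole_coeff \<kappa> s" "ratio \<kappa>\<^sub>0 s = ratio \<kappa> s" for s
    unfolding pole_coeff_def ratio_def sum0 k_def[symmetric] by (simp_all add: \<kappa>\<^sub>0_def)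
  have one: "ratio \<kappa>\<^sub>0 p = 1"
    unfolding same p_def k_def by (rule ratio_gfib_pole)
  obtain K where K: "Re p > - real K" "K > k" by (rule half_plane_exists)
  define I where "I = (SIGMA k:{..<K}. multi_indices {2..l} k)"
  define t where "t \<kappa> s = pole_coeff \<kappa> s * (ratio \<kappa> s / (1 - ratio \<kappa> s))" for \<kappa> s
  have finI: "finite I" unfolding I_def by (intro finite_SigmaI) (auto simp: finite_multi_indices)
  have inI: "(k, \<kappa>\<^sub>0) \<in> I" using \<kappa>\<^sub>0 K by (simp add: I_def)
  define A where "A s = (\<Sum>(k, \<kappa>)\<in>I - {(k, \<kappa>\<^sub>0)}. t \<kappa> s) + (\<Sum>n. binomial_tail c r rel_err K s (Suc n))" for s
  have part: "zeta_part K s = A s + t \<kappa>\<^sub>0 s" for s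
  proof -
    have "(\<Sum>k<K. \<Sum>\<kappa>\<in>multi_indices {2..l} k. t \<kappa> s) = (\<Sum>(k, \<kappa>)\<in>I. t \<kappa> s)"
      unfolding I_def by (intro sum.Sigma) (auto simp: finite_multi_indices)
    also have "\<dots> = t \<kappa>\<^sub>0 s + (\<Sum>(k, \<kappa>)\<in>I - {(k, \<kappa>\<^sub>0)}. t \<kappa> s)"
      using sum.remove[OF finI inI, of "\<lambda>(k, \<kappa>). t \<kappa> s"] by simp
    finally show ?thesis unfolding zeta_part_def A_def t_def by simp
  qed
  have A: "A analytic_on {p}"
    unfolding A_def
  proof (intro analytic_on_add analytic_tail K(1) analytic_on_sum)
    fix y assume y: "y \<in> I - {(k, \<kappa>\<^sub>0)}"
    obtain k' \<kappa>' where y': "y = (k', \<kappa>')" by (cases y)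
    have "ratio \<kappa>' p \<noteq> 1"
    proof
      assume a: "ratio \<kappa>' p = 1"
      have m: "\<kappa>' \<in> multi_indices {2..l} k'" using y y' by (simp add: I_def)
      have "\<kappa>' = \<kappa>\<^sub>0" by (rule ratio_eq_1_unique[OF m \<kappa>\<^sub>0 a one])
      moreover from this have "k' = k" using m sum0 by (simp add: multi_indices_def)
      ultimately show False using y y' by simp
    qed
    then show "(\<lambda>s. case y of (k, \<kappa>) \<Rightarrow> t \<kappa> s) analytic_on {p}"
      unfolding y' t_def prod.case by (rule analytic_pole_term)
  qed
  obtain h where h: "h analytic_on {p}" "h p = 1 / Ln (\<alpha> 1)"
    "eventually (\<lambda>s. exp (- (Ln (\<alpha> 1) * (s - p))) / (1 - exp (- (Ln (\<alpha> 1) * (s - p)))) = h s / (s - p)) (at p)"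
    by (rule geometric_pole[OF Ln_nonzero, of p])
  have "eventually (\<lambda>s. zeta_ext s = zeta_part K s) (at p)"
    using eventually_zeta_ext_eq[OF K(1)] by (simp add: eventually_nhds_conv_at)
  then have ev: "eventually (\<lambda>s. zeta_ext s = A s + (pole_coeff \<kappa> s * h s) / (s - p)) (at p)"
    using h(3)
  proof eventually_elim
    case (elim s)
    then show ?case
      unfolding elim(1) part t_def same ratio_shift[OF one[unfolded same]] elim(2) by simp
  qed
  have ph: "(\<lambda>s. pole_coeff \<kappa> s * h s) analytic_on {p}"
    by (intro analytic_on_mult analytic_pole_coeff h(1))
  show "residue zeta_ext p = gfib_residue l \<alpha> k \<kappa> n"
    using simple_pole_local(1)[OF A ph ev] h(2) gfib_residue_eq[of \<kappa> n] unfolding p_def k_def by simp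
  show "is_pole zeta_ext p \<Longrightarrow> zorder zeta_ext p = -1" by (rule simple_pole_local(2)[OF A ph ev])
  show "zeta_ext meromorphic_on {p}" by (rule simple_pole_local(3)[OF A ph ev])
qed

end

theorem theorem1:
  fixes l :: nat and \<alpha> :: "nat \<Rightarrow> complex"
  assumes "l \<ge> 2"
    and "gfib_roots l \<alpha>"
  shows "\<exists>Z :: complex \<Rightarrow> complex.
           Z meromorphic_on UNIV \<and>
           (\<forall>s. Re s > 0 \<longrightarrow>
              summable (\<lambda>n. gfib_zeta_term l s (Suc n)) \<and> Z s = gfib_zeta l s) \<and>
           Z analytic_on (- gfib_poles l \<alpha>) \<and>
           (\<forall>p \<in> gfib_poles l \<alpha>. is_pole Z p \<longrightarrow> zorder Z p = -1) \<and>
           (\<forall>(k::nat) (\<kappa> :: nat \<Rightarrow> nat) (n::int). k = (\<Sum>i\<in>{2..l}. \<kappa> i) \<longrightarrow>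
              residue Z (gfib_pole l \<alpha> k \<kappa> n) = gfib_residue l \<alpha> k \<kappa> n)"
proof -
  interpret gfib_root_list l \<alpha> using assms by unfold_locales
  have poles: "\<exists>\<kappa> n. p = gfib_pole l \<alpha> (sum \<kappa> {2..l}) \<kappa> n" if "p \<in> gfib_poles l \<alpha>" for p
    using that by (auto simp: gfib_poles_def)
  have "zeta_ext meromorphic_on {p}" for p
  proof (cases "p \<in> gfib_poles l \<alpha>")
    case True
    with poles show ?thesis using zeta_ext_pole(3) by metis
  next
    case False
    then show ?thesis by (intro analytic_on_imp_meromorphic_on zeta_ext_analytic)
  qed
  then have "zeta_ext meromorphic_on UNIV" by (subst meromorphic_on_meromorphic_at) simp
  \<comment> \<open>Order 0 splits off nothing: on \<open>Re s > 0\<close> the extension is the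
    original series.\<close>
  moreover have "summable (\<lambda>n. gfib_zeta_term l s (Suc n)) \<and> zeta_ext s = gfib_zeta l s" if "Re s > 0" for s
    using summable_tail[of 0 s] zeta_ext_eq[of 0 s] that
    by (simp add: gfib_zeta_def gfib_zeta_term_eq zeta_part_def)
  moreover have "zeta_ext analytic_on (- gfib_poles l \<alpha>)"
    using zeta_ext_analytic by (subst analytic_on_analytic_at) auto
  moreover have "zorder zeta_ext p = -1" if "p \<in> gfib_poles l \<alpha>" "is_pole zeta_ext p" for p
    using poles[OF that(1)] zeta_ext_pole(2) that(2) by metis
  ultimately show ?thesis using zeta_ext_pole(1) by (intro exI[of _ zeta_ext]) simp
qed

end
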